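(* In the setting of the context, suppose that $f_X$ is $(\overline H_0,c_0,r)$-upper smooth over $\Omega$ for all $X\in\mathcal X^n$, and that $g_j$ is $(\overline H_j,c_j,0)$-upper smooth for $j=1,\dots,d$. Then, for every symmetric neighborhood $U\subset\mathbb R^p$ of the origin such that $\Omega+U\subset\Omega_0$, $$Z(\lambda)\;\le\;\frac{e^{c(\lambda)}\,\det\big(\overline H(\lambda)\big)^{1/2}}{(2\pi)^{p/2}\,R(\overline H_0;U)}\int_{\Omega+U}e^{-g(\theta,\lambda)}\,d\theta ,$$ where $\overline H(\lambda)=\overline H_0+\sum_{j=1}^d\lambda_j\overline H_j$, $c(\lambda)=c_0+\sum_{j=1}^d\lambda_jc_j$, and $R(H;U)=\mathbb E_{z\sim\mathcal N_p[0,H^{-1}]}\big[\mathbf 1_U(z)\,e^{-r(\|z\|^2)}\big]$.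
   Context: Setting. $\overline{\mathbb R}=\mathbb R\cup\{\infty\}$. $\mathcal X^n$ is a data space with base measure $\nu$. For each $X\in\mathcal X^n$, $f_X:\mathbb R^p\to\overline{\mathbb R}$ is a loss function that is a log-loss: $\int_{\mathcal X^n}e^{-f_X(\theta)}\,d\nu(X)=1$ for all $\theta$ in some closed subset $\Omega_0\subset\mathbb R^p$. The parameter domain is $\Omega\subset\Omega_0$. The penalty is $g(\theta,\lambda)=\sum_{j=1}^d\lambda_jg_j(\theta)$ with $\lambda_j\ge0$ and $\lambda=(\lambda_1,\dots,\lambda_d)\in\mathbb A$, where $\mathbb A\subset\mathbb R^d_+$ is a convex set. It is assumed throughout that a minimizer $\hat\theta(X,\lambda)$ of $f_X(\theta)+g(\theta,\lambda)$ over $\theta\in\Omega$ always exists, and that the penalty is regular: if $\hat\theta(X,\lambda)$ lies in the interior of $\Omega$, then so does $\hat\theta(X,\lambda')$ for all $\lambda'\ge\lambda$. Normalizing factor: $Z(\lambda)=\int_{\mathcal X^n}\max_{\theta\in\Omega}\exp\{-f_X(\theta)-g(\theta,\lambda)\}\,d\nu(X)$. Upper smoothness: a function $f:\mathbb R^p\to\overline{\mathbb R}$ is $(\overline H,c,r)$-upper smooth over $\Omega$, where $\overline H$ is a symmetric positive semidefinite $p\times p$ matrix, $c\ge0$ is a constant and $r:\mathbb R\to[0,\infty]$ is monotone increasing with $r(t^2)=o(t^2)$, if there is a vector-valued function $\xi:\mathbb R^p\to\mathbb R^p$ such that $$f(\psi)-f(\theta)\le c+\langle\xi(\theta),\psi-\theta\rangle+\tfrac12\|\psi-\theta\|_{\overline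 H}^2+r(\|\theta-\psi\|^2)\quad\forall\psi\in\mathbb R^p,\ \forall\theta\in\Omega,$$ where $\|v\|_{H}^2=v^\top Hv$. $\Omega+U=\{\theta+u:\theta\in\Omega,u\in U\}$, $\mathbf 1_U$ is the indicator function of $U$, and $\mathcal N_p[0,H^{-1}]$ is the $p$-dimensional Gaussian distribution with mean $0$ and covariance $H^{-1}$.
   Formalization: The symmetric neighborhood U is additionally assumed convex; for merely symmetric U the bound with R(H_0;U) can fail (e.g. p=1, U a tiny interval together with 3<|t|<4). H_0 is taken invertible so that the Gaussian N_p[0,H_0^{-1}] is defined. *)

theory Defs
  imports "HOL-Analysis.Analysis" "HOL-Library.Set_Algebras"
begin

text \<open>The exponential of an extended real, so that \<open>exp(-f)\<close> makes sense for losses, penalties and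
  remainders that may be infinite.\<close>

fun eexp :: "ereal \<Rightarrow> ennreal" where
  "eexp (ereal x) = ennreal (exp x)"
| "eexp PInfty = \<infinity>"
| "eexp MInfty = 0"

definition psd :: "real ^ 'p ^ 'p \<Rightarrow> bool" where
  "psd H \<longleftrightarrow> transpose H = H \<and> (\<forall>v. 0 \<le> v \<bullet> (H *v v))"

text \<open>The condition \<open>r(t\<^sup>2) = o(t\<^sup>2)\<close> is read as \<open>t \<rightarrow> 0\<close>; since \<open>r\<close> is monotone it forces \<open>r 0 = 0\<close>.
  The term \<open>f \<theta>\<close> is moved to the right-hand side of the inequality to avoid \<open>\<infinity> - \<infinity>\<close>: the two forms
  agree when \<open>f \<theta>\<close> is finite, and nothing is required at points where \<open>f \<theta> = \<infinity>\<close>.\<close>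

definition upper_smooth ::
  "(real ^ 'p \<Rightarrow> ereal) \<Rightarrow> (real ^ 'p) set \<Rightarrow> real ^ 'p ^ 'p \<Rightarrow> real \<Rightarrow> (real \<Rightarrow> ennreal) \<Rightarrow> bool"
where
  "upper_smooth f \<Omega> H c r \<longleftrightarrow>
     psd H \<and> 0 \<le> c \<and> mono r \<and> ((\<lambda>t::real. r (t\<^sup>2) / ennreal (t\<^sup>2)) \<longlongrightarrow> 0) (at 0) \<and>
     (\<exists>\<xi> :: real ^ 'p \<Rightarrow> real ^ 'p. \<forall>\<psi>. \<forall>\<theta>\<in>\<Omega>.
        f \<psi> \<le> f \<theta> + ereal (c + \<xi> \<theta> \<bullet> (\<psi> - \<theta>) + 1 / 2 * ((\<psi> - \<theta>) \<bullet> (H *v (\<psi> - \<theta>))))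
                  + enn2ereal (r ((norm (\<theta> - \<psi>))\<^sup>2)))"

text \<open>In the penalty, \<open>\<lambda>\<^sub>j g\<^sub>j(\<theta>) = 0\<close> when \<open>\<lambda>\<^sub>j = 0\<close>, also if \<open>g\<^sub>j(\<theta>) = \<infinity>\<close>.\<close>

definition penalty :: "('d::finite \<Rightarrow> real ^ 'p \<Rightarrow> ereal) \<Rightarrow> real ^ 'd \<Rightarrow> real ^ 'p \<Rightarrow> ereal" where
  "penalty g lam \<theta> = (\<Sum>j\<in>UNIV. ereal (lam $ j) * g j \<theta>)"

text \<open>The maximum over \<open>\<theta> \<in> \<Omega>\<close> is written as a supremum; it is attained whenever a minimizer of
  \<open>f\<^sub>X + g\<close> over \<open>\<Omega>\<close> exists.\<close>

definition Z_factor ::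
  "'x measure \<Rightarrow> ('x \<Rightarrow> real ^ 'p \<Rightarrow> ereal) \<Rightarrow> ('d::finite \<Rightarrow> real ^ 'p \<Rightarrow> ereal) \<Rightarrow> (real ^ 'p) set
     \<Rightarrow> real ^ 'd \<Rightarrow> ennreal"
where
  "Z_factor \<nu> f g \<Omega> lam = (\<integral>\<^sup>+X. (SUP \<theta>\<in>\<Omega>. eexp (- f X \<theta> - penalty g lam \<theta>)) \<partial>\<nu>)"

text \<open>The Gaussian distribution with mean \<open>\<mu>\<close> and (nonsingular) covariance matrix \<open>\<Sigma>\<close>.\<close>

definition gaussian :: "real ^ 'p \<Rightarrow> real ^ 'p ^ 'p \<Rightarrow> (real ^ 'p) measure" where
  "gaussian \<mu> \<Sigma> = density lborel (\<lambda>z. ennreal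
     (exp (- (1 / 2) * ((z - \<mu>) \<bullet> (matrix_inv \<Sigma> *v (z - \<mu>))))
        / ((2 * pi) powr (real CARD('p) / 2) * sqrt (det \<Sigma>))))"

text \<open>Bounds on \<open>Z_factor\<close> at penalty level \<open>\<lambda>\<close> that involve \<open>R_factor r H0 U\<close> instead of
  \<open>R_factor r (H_bar H0 H \<lambda>) U\<close> rely on Anderson's inequality, hence on \<open>U\<close> being convex as well as
  symmetric: for \<open>p = 1\<close>, \<open>H0 = 1\<close>, \<open>r = 0\<close>, \<open>U\<close> a small interval around 0 together with
  \<open>{t. 3 < \<bar>t\<bar> \<and> \<bar>t\<bar> < 4}\<close>, the former can exceed the latter by an arbitrary factor.\<close>

definition R_factor :: "(real \<Rightarrow> ennreal) \<Rightarrow> real ^ 'p ^ 'p \<Rightarrow> (real ^ 'p) set \<Rightarrow> ennreal" where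
  "R_factor r H U =
     (\<integral>\<^sup>+z. indicator U z * eexp (- enn2ereal (r ((norm z)\<^sup>2))) \<partial>gaussian 0 (matrix_inv H))"

definition H_bar :: "real ^ 'p ^ 'p \<Rightarrow> ('d::finite \<Rightarrow> real ^ 'p ^ 'p) \<Rightarrow> real ^ 'd \<Rightarrow> real ^ 'p ^ 'p" where
  "H_bar H0 H lam = H0 + (\<Sum>j\<in>UNIV. lam $ j *\<^sub>R H j)"

definition c_bar :: "real \<Rightarrow> ('d::finite \<Rightarrow> real) \<Rightarrow> real ^ 'd \<Rightarrow> real" where
  "c_bar c0 c lam = c0 + (\<Sum>j\<in>UNIV. lam $ j * c j)"

end

theory Submission
  imports Defs "HOL-Probability.Distributions"
begin

text \<open>
  Fix \<open>\<theta> \<in> \<Omega>\<close> and put \<open>h = f\<^sub>X + g\<close>. Upper smoothness bounds \<open>exp (- h (\<theta> + u))\<close> from below by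
  \<open>exp (- h \<theta> - c)\<close> times the Gaussian weight with precision matrix \<open>H_bar\<close> and the weights \<open>exp (- r)\<close>
  and \<open>exp (- (\<xi> \<bullet> u))\<close>. Integrating over the symmetric set \<open>U\<close> removes the last factor, since
  \<open>cosh \<ge> 1\<close>. So \<open>exp (- h \<theta>)\<close> is at most a constant times the integral of \<open>exp (- h)\<close> over \<open>\<Omega> + U\<close>;
  integrating over \<open>X\<close> and using Tonelli and the log-loss property gives the bound, with the Gaussian
  expectation taken for \<open>H_bar\<close> instead of \<open>H0\<close>.

  That the expectation for \<open>H0\<close> is the smaller one is a consequence of Anderson's inequality, which follows from the
  Prekopa--Leindler inequality: \<open>H_bar - H0\<close> is a sum of matrices \<open>w w\<^sup>T\<close>, and the Gaussian with
  precision \<open>K\<close> is a mixture of translates of the one with precision \<open>K + w w\<^sup>T\<close>.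
\<close>

section \<open>The Prekopa--Leindler inequality\<close>

lemma emeasure_lborel_greaterThan: "emeasure lborel {a<..} = top" for a :: real
proof -
  have "of_nat n \<le> emeasure lborel {a<..}" for n
  proof -
    have "of_nat n = emeasure lborel {a<..<a + real n}"
      by (simp add: ennreal_of_nat_eq_real_of_nat)
    also have "\<dots> \<le> emeasure lborel {a<..}"
      by (intro emeasure_mono) auto
    finally show ?thesis .
  qed
  then have "(SUP n. of_nat n) \<le> emeasure lborel {a<..}"
    by (rule SUP_least)
  then show ?thesis
    by (simp add: ennreal_SUP_of_nat_eq_top top_unique)
qed

lemma nn_integral_mult_layer_cake:
  fixes f k :: "'a \<Rightarrow> ennreal"
  assumes "sigma_finite_measure M"
    and [measurable]: "f \<in> borel_measurable M" "k \<in> borel_measurable M"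
  shows "(\<integral>\<^sup>+x. f x * k x \<partial>M)
    = (\<integral>\<^sup>+s. indicator {0<..} s * (\<integral>\<^sup>+x. indicator {x. ennreal s < f x} x * k x \<partial>M) \<partial>lborel)"
proof -
  interpret pair_sigma_finite M "lborel :: real measure"
    using assms(1) by (simp add: pair_sigma_finite_def sigma_finite_lborel)
  have level: "y = (\<integral>\<^sup>+s. indicator {s. 0 < s \<and> ennreal s < y} s \<partial>lborel)" for y
  proof (cases y)
    case (real c)
    then have "{s. 0 < s \<and> ennreal s < y} = {0<..<c}"
      by (auto simp: ennreal_less_iff)
    with real show ?thesis by simp
  next
    case top
    then have "{s. 0 < s \<and> ennreal s < y} = {0<..}"
      by auto
    then show ?thesis
      using top emeasure_lborel_greaterThan by simp
  qed
  have "(\<integral>\<^sup>+x. f x * k x \<partial>M) = (\<integral>\<^sup>+x. (\<integral>\<^sup>+s. indicator {s. 0 < s \<and> ennreal s < f x} s \<partial>lborel) * k x \<partial>M)"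
    using level by simp
  also have "\<dots> = (\<integral>\<^sup>+x. (\<integral>\<^sup>+s. indicator {s. 0 < s \<and> ennreal s < f x} s * k x \<partial>lborel) \<partial>M)"
    by (subst nn_integral_multc) auto
  also have "\<dots> = (\<integral>\<^sup>+s. (\<integral>\<^sup>+x. indicator {s. 0 < s \<and> ennreal s < f x} s * k x \<partial>M) \<partial>lborel)"
    by (rule Fubini'[symmetric]) measurable
  also have "\<dots> = (\<integral>\<^sup>+s. (\<integral>\<^sup>+x. indicator {0<..} s * (indicator {x. ennreal s < f x} x * k x) \<partial>M) \<partial>lborel)"
    by (intro nn_integral_cong) (auto simp: indicator_def)
  also have "\<dots> = (\<integral>\<^sup>+s. indicator {0<..} s * (\<integral>\<^sup>+x. indicator {x. ennreal s < f x} x * k x \<partial>M) \<partial>lborel)"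
    by (intro nn_integral_cong nn_integral_cmult) measurable
  finally show ?thesis .
qed

lemma nn_integral_layer_cake:
  fixes f :: "'a \<Rightarrow> ennreal"
  assumes "sigma_finite_measure M" and [measurable]: "f \<in> borel_measurable M"
  shows "(\<integral>\<^sup>+x. f x \<partial>M) = (\<integral>\<^sup>+s. emeasure M {x \<in> space M. 0 < s \<and> ennreal s < f x} \<partial>lborel)"
proof -
  have "(\<integral>\<^sup>+x. f x \<partial>M) = (\<integral>\<^sup>+s. indicator {0<..} s * (\<integral>\<^sup>+x. indicator {x. ennreal s < f x} x \<partial>M) \<partial>lborel)"
    using nn_integral_mult_layer_cake[OF assms, of "\<lambda>_. 1"] by simp
  also have "\<dots> = (\<integral>\<^sup>+s. emeasure M {x \<in> space M. 0 < s \<and> ennreal s < f x} \<partial>lborel)"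
  proof (intro nn_integral_cong)
    fix s :: real
    have "(\<integral>\<^sup>+x. indicator {x. ennreal s < f x} x \<partial>M) = (\<integral>\<^sup>+x. indicator {x \<in> space M. ennreal s < f x} x \<partial>M)"
      by (intro nn_integral_cong) (simp add: indicator_def)
    then show "indicator {0<..} s * (\<integral>\<^sup>+x. indicator {x. ennreal s < f x} x \<partial>M)
        = emeasure M {x \<in> space M. 0 < s \<and> ennreal s < f x}"
      by (cases "0 < s") simp_all
  qed
  finally show ?thesis .
qed

lemma emeasure_Int_atMost_SUP:
  fixes A :: "real set"
  assumes [measurable]: "A \<in> sets borel" and "A \<noteq> {}"
  shows "emeasure lborel A = (SUP a\<in>A. emeasure lborel (A \<inter> {..a}))"
proof (cases "\<exists>m\<in>A. \<forall>x\<in>A. x \<le> m")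
  case True
  then obtain m where m: "m \<in> A" "\<forall>x\<in>A. x \<le> m" by blast
  then have "A \<inter> {..m} = A" by auto
  then show ?thesis
    using m(1) by (intro antisym SUP_least SUP_upper2[OF m(1)] emeasure_mono) auto
next
  case False
  obtain X :: "nat \<Rightarrow> ereal" where X: "incseq X" "range X \<subseteq> ereal ` A" "Sup (ereal ` A) = (SUP i. X i)"
    using Sup_countable_SUP[of "ereal ` A"] assms(2) by blast
  define a where "a i = real_of_ereal (X i)" for i
  have aA: "a i \<in> A" and Xa: "X i = ereal (a i)" for i
    using X(2) by (auto simp: a_def subset_iff image_iff) (metis rangeI real_of_ereal.simps(1))+
  have inc: "incseq (\<lambda>i. A \<inter> {..a i})"
    using X(1) by (fastforce simp: incseq_def Xa)
  have cofinal: "\<exists>i. x \<le> a i" if x: "x \<in> A" for x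
  proof -
    obtain y where "y \<in> A" "x < y"
      using False x by force
    then have "ereal x < Sup (ereal ` A)"
      by (intro less_SUP_iff[THEN iffD2]) auto
    then show ?thesis
      by (auto simp: X(3) less_SUP_iff Xa intro: less_imp_le)
  qed
  have "emeasure lborel A = emeasure lborel (\<Union>i. A \<inter> {..a i})"
    using cofinal by (intro arg_cong[where f="emeasure lborel"]) auto
  also have "\<dots> = (SUP i. emeasure lborel (A \<inter> {..a i}))"
    by (rule SUP_emeasure_incseq[symmetric]) (use inc in auto)
  also have "\<dots> \<le> (SUP a\<in>A. emeasure lborel (A \<inter> {..a}))"
    by (intro SUP_least SUP_upper2[OF aA]) auto
  finally show ?thesis
    by (intro antisym SUP_least emeasure_mono) auto
qed

lemma emeasure_lborel_uminus:
  fixes A :: "real set"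
  assumes [measurable]: "A \<in> sets borel"
  shows "emeasure lborel (uminus ` A) = emeasure lborel A"
proof -
  have "emeasure lborel A = emeasure (distr lborel borel uminus) A"
    by (simp add: lborel_distr_uminus)
  also have "\<dots> = emeasure lborel (uminus -` A)"
    by (subst emeasure_distr) auto
  also have "uminus -` A = uminus ` A"
    by force
  finally show ?thesis ..
qed

lemma uminus_image_borel:
  fixes A :: "real set"
  assumes "A \<in> sets borel"
  shows "uminus ` A \<in> sets borel"
proof -
  have "uminus ` A = uminus -` A \<inter> space borel"
    by force
  then show ?thesis
    using measurable_sets[OF _ assms, of uminus borel] by simp
qed

lemma emeasure_Int_atLeast_SUP:
  fixes A :: "real set"
  assumes A: "A \<in> sets borel" "A \<noteq> {}"
  shows "emeasure lborel A = (SUP a\<in>A. emeasure lborel (A \<inter> {a..}))"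
proof -
  have "emeasure lborel (uminus ` A \<inter> {..- a}) = emeasure lborel (A \<inter> {a..})" for a
  proof -
    have "uminus ` A \<inter> {..- a} = uminus ` (A \<inter> {a..})" by auto
    then show ?thesis
      using A by (simp add: emeasure_lborel_uminus)
  qed
  then show ?thesis
    using emeasure_Int_atMost_SUP[of "uminus ` A"] A
    by (simp add: uminus_image_borel emeasure_lborel_uminus image_image)
qed

text \<open>For \<open>a \<in> A\<close> and \<open>b \<in> B\<close>, the midpoints of \<open>A \<inter> {..a}\<close> with \<open>b\<close> and of \<open>a\<close> with \<open>B \<inter> {b..}\<close> lie on
  different sides of \<open>(a + b) / 2\<close>.\<close>

lemma Brunn_Minkowski_real:
  fixes A B C :: "real set"
  assumes A[measurable]: "A \<in> sets borel" and B[measurable]: "B \<in> sets borel"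
    and C[measurable]: "C \<in> sets borel"
    and ne: "A \<noteq> {}" "B \<noteq> {}"
    and mid: "\<And>x y. x \<in> A \<Longrightarrow> y \<in> B \<Longrightarrow> (x + y) / 2 \<in> C"
  shows "emeasure lborel A + emeasure lborel B \<le> 2 * emeasure lborel C"
proof -
  have scale: "2 * emeasure lborel D = emeasure lborel {x. (x + b) / 2 \<in> D}"
    if [measurable]: "D \<in> sets borel" for D :: "real set" and b
  proof -
    have "emeasure lborel D = (\<integral>\<^sup>+x. indicator D x \<partial>lborel)"
      by simp
    also have "\<dots> = ennreal \<bar>1/2\<bar> * (\<integral>\<^sup>+x. indicator D (b/2 + 1/2 * x) \<partial>lborel)"
      by (rule nn_integral_real_affine) auto
    also have "(\<integral>\<^sup>+x. indicator D (b/2 + 1/2 * x) \<partial>lborel)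
        = (\<integral>\<^sup>+x. indicator {x. (x + b) / 2 \<in> D} x \<partial>lborel)"
      by (intro nn_integral_cong) (simp add: indicator_def add_divide_distrib add.commute)
    also have "\<dots> = emeasure lborel {x. (x + b) / 2 \<in> D}"
      by (rule nn_integral_indicator) measurable
    finally have "emeasure lborel D = ennreal (1/2) * emeasure lborel {x. (x + b) / 2 \<in> D}"
      by simp
    then have "2 * emeasure lborel D = (ennreal 2 * ennreal (1/2)) * emeasure lborel {x. (x + b) / 2 \<in> D}"
      by (simp add: mult.assoc)
    also have "ennreal 2 * ennreal (1/2) = 1"
      by (subst ennreal_mult[symmetric]) auto
    finally show ?thesis by simp
  qed
  have key: "emeasure lborel (A \<inter> {..a}) + emeasure lborel (B \<inter> {b..}) \<le> 2 * emeasure lborel C"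
    if a: "a \<in> A" and b: "b \<in> B" for a b
  proof -
    let ?p = "(a + b) / 2"
    have "emeasure lborel (A \<inter> {..a}) \<le> 2 * emeasure lborel (C \<inter> {..?p})"
      unfolding scale[of "C \<inter> {..?p}" b, simplified]
      using mid[OF _ b] by (intro emeasure_mono) auto
    moreover have "emeasure lborel (B \<inter> {b..}) \<le> 2 * emeasure lborel (C \<inter> {?p<..})"
    proof -
      have "emeasure lborel (B \<inter> {b..}) = emeasure lborel (B \<inter> {b<..})"
        by (rule emeasure_eq_AE) (use AE_lborel_singleton[of b] in \<open>auto elim!: eventually_mono\<close>)
      also have "\<dots> \<le> 2 * emeasure lborel (C \<inter> {?p<..})"
        unfolding scale[of "C \<inter> {?p<..}" a, simplified]
        using mid[OF a] by (intro emeasure_mono) (auto simp: add.commute)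
      finally show ?thesis .
    qed
    ultimately have "emeasure lborel (A \<inter> {..a}) + emeasure lborel (B \<inter> {b..})
        \<le> 2 * (emeasure lborel (C \<inter> {..?p}) + emeasure lborel (C \<inter> {?p<..}))"
      unfolding distrib_left by (rule add_mono)
    also have "emeasure lborel (C \<inter> {..?p}) + emeasure lborel (C \<inter> {?p<..}) = emeasure lborel C"
      by (subst plus_emeasure) (auto intro!: arg_cong[where f="emeasure lborel"])
    finally show ?thesis .
  qed
  have half: "emeasure lborel A + emeasure lborel (B \<inter> {b..}) \<le> 2 * emeasure lborel C" if "b \<in> B" for b
    unfolding emeasure_Int_atMost_SUP[OF A ne(1)]
    by (subst ennreal_SUP_add_left[OF ne(1), symmetric]) (intro SUP_least key that)
  show ?thesis
    unfolding emeasure_Int_atLeast_SUP[OF B ne(2)]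
    by (subst ennreal_SUP_add_right[OF ne(2)]) (intro SUP_least half)
qed


lemma ennreal_mult_self_le_iff: "a * a \<le> b * b \<longleftrightarrow> a \<le> b" for a b :: ennreal
proof
  show "a \<le> b" if *: "a * a \<le> b * b"
  proof (cases a; cases b)
    fix x y :: real assume "0 \<le> x" "a = ennreal x" "0 \<le> y" "b = ennreal y"
    with * show ?thesis
      by (simp add: ennreal_mult[symmetric] ennreal_le_iff abs_le_square_iff[symmetric] power2_eq_square)
        (metis abs_le_square_iff abs_of_nonneg power2_eq_square)
  qed (use * in \<open>auto simp: ennreal_mult_eq_top_iff top_unique\<close>)
qed (rule mult_mono, auto)

lemma ennreal_mult_le_of_add_le:
  fixes a b c :: ennreal
  assumes "a + b \<le> 2 * c"
  shows "a * b \<le> c * c"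
proof (cases c)
  case c: (real z)
  then have "2 * c < top"
    by (simp add: ennreal_mult_less_top)
  with assms have "a + b < top"
    by (rule order_le_less_trans)
  then obtain x y where xy: "0 \<le> x" "a = ennreal x" "0 \<le> y" "b = ennreal y"
    by (cases a; cases b) auto
  have "x + y \<le> 2 * z"
    using assms c xy by (simp add: ennreal_plus[symmetric] ennreal_mult'[symmetric] flip: ennreal_numeral del: ennreal_plus)
  then have "(x + y)\<^sup>2 \<le> (2 * z)\<^sup>2"
    using xy by (intro power_mono) auto
  moreover have "4 * (x * y) \<le> (x + y)\<^sup>2"
    using zero_le_power2[of "x - y"] by (simp add: power2_eq_square algebra_simps)
  ultimately have "x * y \<le> z * z"
    by (simp add: power2_eq_square)
  then show ?thesis
    using c xy by (simp add: ennreal_mult[symmetric])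
qed (simp add: ennreal_mult_eq_top_iff)

lemma Prekopa_Leindler_real_normalized:
  fixes F G H :: "real \<Rightarrow> ennreal"
  assumes [measurable]: "F \<in> borel_measurable borel" "G \<in> borel_measurable borel"
      "H \<in> borel_measurable borel"
    and mid: "\<And>x y. F x * G y \<le> H ((x + y) / 2) * H ((x + y) / 2)"
    and sup: "(SUP x. F x) = 1" "(SUP x. G x) = 1"
  shows "(\<integral>\<^sup>+x. F x \<partial>lborel) * (\<integral>\<^sup>+x. G x \<partial>lborel) \<le> (\<integral>\<^sup>+x. H x \<partial>lborel) * (\<integral>\<^sup>+x. H x \<partial>lborel)"
proof -
  let ?L = "\<lambda>f s. emeasure lborel {x \<in> space lborel. 0 < s \<and> ennreal s < f x}"
  have level: "?L F s + ?L G s \<le> 2 * ?L H s" for s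
  proof (cases "0 < s \<and> s < 1")
    case True
    then have "ennreal s < 1"
      by (simp add: ennreal_less_one_iff)
    then obtain x0 y0 where "ennreal s < F x0" "ennreal s < G y0"
      using sup by (metis less_SUP_iff)
    moreover have "ennreal s < H ((x + y) / 2)" if "ennreal s < F x" "ennreal s < G y" for x y
    proof -
      have "min (F x) (G y) * min (F x) (G y) \<le> H ((x + y) / 2) * H ((x + y) / 2)"
        by (rule order_trans[OF mult_mono mid]) auto
      then have "min (F x) (G y) \<le> H ((x + y) / 2)"
        by (simp only: ennreal_mult_self_le_iff)
      moreover have "ennreal s < min (F x) (G y)"
        using that by simp
      ultimately show ?thesis
        by (rule less_le_trans[rotated])
    qed
    ultimately show ?thesis
      using True by (intro Brunn_Minkowski_real) auto
  next
    case False
    have "F x \<le> 1" "G x \<le> 1" for x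
      using SUP_upper[of x UNIV F] SUP_upper[of x UNIV G] sup by auto
    moreover have "1 \<le> ennreal s" if "0 < s"
      using that False by simp
    ultimately have "\<not> (0 < s \<and> ennreal s < F x)" "\<not> (0 < s \<and> ennreal s < G x)" for x
      by (meson leD order_trans)+
    then have "{x \<in> space lborel. 0 < s \<and> ennreal s < F x} = {}"
        "{x \<in> space lborel. 0 < s \<and> ennreal s < G x} = {}"
      by auto
    then show ?thesis
      by (simp only: emeasure_empty add_0 zero_le)
  qed
  have "(\<integral>\<^sup>+x. F x \<partial>lborel) + (\<integral>\<^sup>+x. G x \<partial>lborel) = (\<integral>\<^sup>+s. ?L F s + ?L G s \<partial>lborel)"
    by (simp add: nn_integral_layer_cake[of lborel F] nn_integral_layer_cake[of lborel G]
        sigma_finite_lborel nn_integral_add)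
  also have "\<dots> \<le> (\<integral>\<^sup>+s. 2 * ?L H s \<partial>lborel)"
    by (intro nn_integral_mono level)
  also have "\<dots> = 2 * (\<integral>\<^sup>+x. H x \<partial>lborel)"
    by (simp add: nn_integral_layer_cake[of lborel H] sigma_finite_lborel nn_integral_cmult)
  finally show ?thesis
    by (rule ennreal_mult_le_of_add_le)
qed

lemma Prekopa_Leindler_real_bounded:
  fixes F G H :: "real \<Rightarrow> ennreal"
  assumes [measurable]: "F \<in> borel_measurable borel" "G \<in> borel_measurable borel"
      "H \<in> borel_measurable borel"
    and mid: "\<And>x y. F x * G y \<le> H ((x + y) / 2) * H ((x + y) / 2)"
    and fin: "(SUP x. F x) < top" "(SUP x. G x) < top"
  shows "(\<integral>\<^sup>+x. F x \<partial>lborel) * (\<integral>\<^sup>+x. G x \<partial>lborel) \<le> (\<integral>\<^sup>+x. H x \<partial>lborel) * (\<integral>\<^sup>+x. H x \<partial>lborel)"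
proof (cases "(SUP x. F x) = 0 \<or> (SUP x. G x) = 0")
  case True
  then have "(\<forall>x. F x = 0) \<or> (\<forall>x. G x = 0)"
    by (metis SUP_upper UNIV_I le_zero_eq)
  then show ?thesis
    by auto
next
  case False
  obtain m where m: "0 \<le> m" "(SUP x. F x) = ennreal m"
    using fin(1) by (cases "SUP x. F x") auto
  obtain n where n: "0 \<le> n" "(SUP x. G x) = ennreal n"
    using fin(2) by (cases "SUP x. G x") auto
  have pos: "0 < m" "0 < n"
    using False m n by (auto simp: less_le)
  define k where "k = 1 / sqrt (m * n)"
  have k: "0 \<le> k" "k * k = 1/m * (1/n)"
    using pos by (auto simp: k_def field_simps)
  have k': "ennreal k * ennreal k = ennreal (1/m) * ennreal (1/n)"
    using k pos by (simp add: ennreal_mult[symmetric])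
  let ?F = "\<lambda>x. ennreal (1/m) * F x" and ?G = "\<lambda>x. ennreal (1/n) * G x" and ?H = "\<lambda>x. ennreal k * H x"
  have "(\<integral>\<^sup>+x. ?F x \<partial>lborel) * (\<integral>\<^sup>+x. ?G x \<partial>lborel) \<le> (\<integral>\<^sup>+x. ?H x \<partial>lborel) * (\<integral>\<^sup>+x. ?H x \<partial>lborel)"
  proof (rule Prekopa_Leindler_real_normalized)
    show "?F x * ?G y \<le> ?H ((x + y) / 2) * ?H ((x + y) / 2)" for x y
    proof -
      have "?F x * ?G y = (ennreal (1/m) * ennreal (1/n)) * (F x * G y)"
        by (simp add: ac_simps)
      also have "\<dots> \<le> (ennreal k * ennreal k) * (H ((x + y) / 2) * H ((x + y) / 2))"
        unfolding k' by (intro mult_left_mono mid) auto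
      finally show ?thesis by (simp add: ac_simps)
    qed
    show "(SUP x. ?F x) = 1" "(SUP x. ?G x) = 1"
      using m n pos by (simp_all add: SUP_mult_left_ennreal[symmetric] ennreal_mult[symmetric])
  qed auto
  then have "(ennreal k * ennreal k) * ((\<integral>\<^sup>+x. F x \<partial>lborel) * (\<integral>\<^sup>+x. G x \<partial>lborel))
      \<le> (ennreal k * ennreal k) * ((\<integral>\<^sup>+x. H x \<partial>lborel) * (\<integral>\<^sup>+x. H x \<partial>lborel))"
    unfolding k' by (simp add: nn_integral_cmult) (simp add: k'[symmetric] ac_simps)
  moreover have "0 < ennreal k * ennreal k" "ennreal k * ennreal k < top"
    using pos by (auto simp: k_def ennreal_zero_less_mult_iff ennreal_mult_less_top)
  ultimately show ?thesis
    by (subst (asm) ennreal_mult_le_mult_iff) auto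
qed

lemma nn_integral_SUP_min:
  assumes [measurable]: "f \<in> borel_measurable M"
  shows "(\<integral>\<^sup>+x. f x \<partial>M) = (SUP n::nat. \<integral>\<^sup>+x. min (f x) (of_nat n) \<partial>M)"
proof -
  have "f x = (SUP n::nat. min (f x) (of_nat n))" for x
  proof -
    have "(SUP n::nat. min (f x) (of_nat n)) = min (f x) (SUP n::nat. of_nat n)"
      by (simp add: inf_min[symmetric] inf_SUP)
    then show ?thesis
      by (simp add: ennreal_SUP_of_nat_eq_top)
  qed
  then have "(\<integral>\<^sup>+x. f x \<partial>M) = (\<integral>\<^sup>+x. (SUP n::nat. min (f x) (of_nat n)) \<partial>M)"
    by simp
  also have "\<dots> = (SUP n::nat. \<integral>\<^sup>+x. min (f x) (of_nat n) \<partial>M)"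
    by (rule nn_integral_monotone_convergence_SUP)
      (auto simp: incseq_def le_fun_def min_le_iff_disj intro: min.coboundedI2)
  finally show ?thesis .
qed

lemma Prekopa_Leindler_real:
  fixes F G H :: "real \<Rightarrow> ennreal"
  assumes [measurable]: "F \<in> borel_measurable borel" "G \<in> borel_measurable borel"
      "H \<in> borel_measurable borel"
    and mid: "\<And>x y. F x * G y \<le> H ((x + y) / 2) * H ((x + y) / 2)"
  shows "(\<integral>\<^sup>+x. F x \<partial>lborel) * (\<integral>\<^sup>+x. G x \<partial>lborel) \<le> (\<integral>\<^sup>+x. H x \<partial>lborel) * (\<integral>\<^sup>+x. H x \<partial>lborel)"
proof -
  let ?F = "\<lambda>n::nat. \<lambda>x. min (F x) (of_nat n)" and ?G = "\<lambda>n::nat. \<lambda>x. min (G x) (of_nat n)"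
  let ?R = "(\<integral>\<^sup>+x. H x \<partial>lborel) * (\<integral>\<^sup>+x. H x \<partial>lborel)"
  have "(\<integral>\<^sup>+x. ?F m x \<partial>lborel) * (\<integral>\<^sup>+x. ?G n x \<partial>lborel) \<le> ?R" for m n
  proof (rule Prekopa_Leindler_real_bounded)
    show "?F m x * ?G n y \<le> H ((x + y) / 2) * H ((x + y) / 2)" for x y
      by (rule order_trans[OF mult_mono mid]) auto
    have "(SUP x. min (h x) (of_nat n)) < top" for h :: "real \<Rightarrow> ennreal" and n
    proof -
      have "(SUP x. min (h x) (of_nat n)) \<le> of_nat n"
        by (rule SUP_least) auto
      then show ?thesis
        by (rule order_le_less_trans) (simp add: of_nat_less_top)
    qed
    then show "(SUP x. ?F m x) < top" "(SUP x. ?G n x) < top"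
      by auto
  qed auto
  then have "(\<integral>\<^sup>+x. ?F m x \<partial>lborel) * (\<integral>\<^sup>+x. G x \<partial>lborel) \<le> ?R" for m
    unfolding nn_integral_SUP_min[of G lborel, simplified] SUP_mult_left_ennreal
    by (intro SUP_least)
  then show ?thesis
    unfolding nn_integral_SUP_min[of F lborel, simplified] SUP_mult_right_ennreal
    by (intro SUP_least)
qed

lemma Prekopa_Leindler_PiM:
  fixes f g h :: "('i \<Rightarrow> real) \<Rightarrow> ennreal"
  assumes "finite I"
    and "f \<in> borel_measurable (\<Pi>\<^sub>M i\<in>I. lborel)" "g \<in> borel_measurable (\<Pi>\<^sub>M i\<in>I. lborel)"
      "h \<in> borel_measurable (\<Pi>\<^sub>M i\<in>I. lborel)"
    and "\<And>x y. x \<in> extensional I \<Longrightarrow> y \<in> extensional I \<Longrightarrow>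
      f x * g y \<le> h (\<lambda>i\<in>I. (x i + y i) / 2) * h (\<lambda>i\<in>I. (x i + y i) / 2)"
  shows "(\<integral>\<^sup>+x. f x \<partial>(\<Pi>\<^sub>M i\<in>I. lborel)) * (\<integral>\<^sup>+x. g x \<partial>(\<Pi>\<^sub>M i\<in>I. lborel))
    \<le> (\<integral>\<^sup>+x. h x \<partial>(\<Pi>\<^sub>M i\<in>I. lborel)) * (\<integral>\<^sup>+x. h x \<partial>(\<Pi>\<^sub>M i\<in>I. lborel))"
  using assms
proof (induction I arbitrary: f g h rule: finite_induct)
  case empty
  interpret product_sigma_finite "\<lambda>_::'i. lborel :: real measure"
    by (simp add: product_sigma_finite_def sigma_finite_lborel)
  show ?case
    using empty(4)[of "\<lambda>_. undefined" "\<lambda>_. undefined"]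
    by (simp add: PiM_empty nn_integral_count_space_finite restrict_def)
next
  case (insert i I)
  interpret product_sigma_finite "\<lambda>_::'i. lborel :: real measure"
    by (simp add: product_sigma_finite_def sigma_finite_lborel)
  interpret I: sigma_finite_measure "\<Pi>\<^sub>M i\<in>I. lborel :: real measure"
    by (rule sigma_finite) fact
  note [measurable] = insert.prems(1-3)
  have slice[measurable]: "(\<lambda>(t, x). k (x(i := t))) \<in> borel_measurable (borel \<Otimes>\<^sub>M (\<Pi>\<^sub>M i\<in>I. lborel))"
    if [measurable]: "k \<in> borel_measurable (\<Pi>\<^sub>M i\<in>insert i I. lborel)" for k :: "('i \<Rightarrow> real) \<Rightarrow> ennreal"
    by measurable
  let ?S = "\<lambda>k t. \<integral>\<^sup>+x. k (x(i := t)) \<partial>(\<Pi>\<^sub>M i\<in>I. lborel)"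
  have int: "integral\<^sup>N (\<Pi>\<^sub>M i\<in>insert i I. lborel) k = (\<integral>\<^sup>+t. ?S k t \<partial>lborel)"
    if "k \<in> borel_measurable (\<Pi>\<^sub>M i\<in>insert i I. lborel)" for k :: "('i \<Rightarrow> real) \<Rightarrow> ennreal"
    using product_nn_integral_insert_rev[OF insert.hyps that] by simp
  have "?S f s * ?S g t \<le> ?S h ((s + t) / 2) * ?S h ((s + t) / 2)" for s t
  proof (rule insert.IH)
    fix x y :: "'i \<Rightarrow> real" assume "x \<in> extensional I" "y \<in> extensional I"
    then have "x(i := s) \<in> extensional (insert i I)" "y(i := t) \<in> extensional (insert i I)"
      by (auto simp: extensional_def)
    from insert.prems(4)[OF this]
    have "f (x(i := s)) * g (y(i := t)) \<le> h (\<lambda>j\<in>insert i I. ((x(i := s)) j + (y(i := t)) j) / 2)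
        * h (\<lambda>j\<in>insert i I. ((x(i := s)) j + (y(i := t)) j) / 2)" .
    also have "(\<lambda>j\<in>insert i I. ((x(i := s)) j + (y(i := t)) j) / 2)
        = (\<lambda>j\<in>I. (x j + y j) / 2)(i := (s + t) / 2)"
      using insert.hyps by (auto simp: fun_eq_iff restrict_def)
    finally show "f (x(i := s)) * g (y(i := t))
        \<le> h ((\<lambda>j\<in>I. (x j + y j) / 2)(i := (s + t) / 2)) * h ((\<lambda>j\<in>I. (x j + y j) / 2)(i := (s + t) / 2))" .
  qed measurable
  then have "(\<integral>\<^sup>+t. ?S f t \<partial>lborel) * (\<integral>\<^sup>+t. ?S g t \<partial>lborel) \<le> (\<integral>\<^sup>+t. ?S h t \<partial>lborel) * (\<integral>\<^sup>+t. ?S h t \<partial>lborel)"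
    by (intro Prekopa_Leindler_real) measurable
  then show ?case
    by (simp add: int)
qed

lemma Prekopa_Leindler:
  fixes f g h :: "'a::euclidean_space \<Rightarrow> ennreal"
  assumes [measurable]: "f \<in> borel_measurable borel" "g \<in> borel_measurable borel" "h \<in> borel_measurable borel"
    and mid: "\<And>x y. f x * g y \<le> h ((x + y) /\<^sub>R 2) * h ((x + y) /\<^sub>R 2)"
  shows "(\<integral>\<^sup>+x. f x \<partial>lborel) * (\<integral>\<^sup>+x. g x \<partial>lborel) \<le> (\<integral>\<^sup>+x. h x \<partial>lborel) * (\<integral>\<^sup>+x. h x \<partial>lborel)"
proof -
  let ?T = "\<lambda>x. \<Sum>b\<in>(Basis::'a set). x b *\<^sub>R b"
  have [measurable]: "?T \<in> (\<Pi>\<^sub>M b\<in>Basis. lborel) \<rightarrow>\<^sub>M borel"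
    by measurable
  have int: "(\<integral>\<^sup>+x. k x \<partial>lborel) = (\<integral>\<^sup>+x. k (?T x) \<partial>(\<Pi>\<^sub>M b\<in>Basis. lborel))"
    if "k \<in> borel_measurable borel" for k :: "'a \<Rightarrow> ennreal"
    by (subst lborel_eq, subst nn_integral_distr) (use that in simp_all)
  have "?T (\<lambda>b\<in>Basis. (x b + y b) / 2) = (?T x + ?T y) /\<^sub>R 2" for x y
    by (simp add: scaleR_sum_right sum.distrib[symmetric] algebra_simps add_divide_distrib)
  then show ?thesis
    unfolding int[OF assms(1)] int[OF assms(2)] int[OF assms(3)]
    using mid by (intro Prekopa_Leindler_PiM) auto
qed

section \<open>Anderson's inequality\<close>

lemma lborel_distr_uminus_euclidean:
  "distr lborel borel uminus = (lborel :: 'a::euclidean_space measure)"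
  by (subst lborel_affine[of "-1" 0]) (auto simp: density_1)

lemma nn_integral_lborel_uminus:
  fixes f :: "'a::euclidean_space \<Rightarrow> ennreal"
  assumes [measurable]: "f \<in> borel_measurable borel"
  shows "(\<integral>\<^sup>+x. f (- x) \<partial>lborel) = (\<integral>\<^sup>+x. f x \<partial>lborel)"
proof -
  have "(\<integral>\<^sup>+x. f x \<partial>lborel) = (\<integral>\<^sup>+x. f x \<partial>distr lborel borel uminus)"
    by (simp add: lborel_distr_uminus_euclidean)
  also have "\<dots> = (\<integral>\<^sup>+x. f (- x) \<partial>lborel)"
    by (subst nn_integral_distr) auto
  finally show ?thesis ..
qed

lemma nn_integral_lborel_translation:
  fixes f :: "'a::euclidean_space \<Rightarrow> ennreal"
  assumes [measurable]: "f \<in> borel_measurable borel"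
  shows "(\<integral>\<^sup>+x. f (a + x) \<partial>lborel) = (\<integral>\<^sup>+x. f x \<partial>lborel)"
proof -
  have "(\<integral>\<^sup>+x. f x \<partial>lborel) = (\<integral>\<^sup>+x. f x \<partial>distr lborel borel ((+) a))"
    by (simp add: lborel_distr_plus)
  also have "\<dots> = (\<integral>\<^sup>+x. f (a + x) \<partial>lborel)"
    by (subst nn_integral_distr) auto
  finally show ?thesis ..
qed

lemma Anderson:
  fixes q k :: "'a::euclidean_space \<Rightarrow> ennreal"
  assumes [measurable]: "q \<in> borel_measurable borel" "k \<in> borel_measurable borel"
    and q_even: "\<And>x. q (- x) = q x"
    and q_quasiconcave: "\<And>x y. min (q x) (q y) \<le> q ((x + y) /\<^sub>R 2)"
    and k_even: "\<And>x. k (- x) = k x"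
    and k_logconcave: "\<And>x y. k x * k y \<le> k ((x + y) /\<^sub>R 2) * k ((x + y) /\<^sub>R 2)"
  shows "(\<integral>\<^sup>+y. q (y + w) * k y \<partial>lborel) \<le> (\<integral>\<^sup>+y. q y * k y \<partial>lborel)"
proof -
  let ?I = "\<lambda>s w. \<integral>\<^sup>+y. indicator {y. ennreal s < q (y + w)} y * k y \<partial>lborel"
  have level: "?I s w \<le> ?I s 0" for s
  proof -
    let ?h = "\<lambda>w y. indicator {y. ennreal s < q (y + w)} y * k y"
    have "?h w x * ?h (- w) y \<le> ?h 0 ((x + y) /\<^sub>R 2) * ?h 0 ((x + y) /\<^sub>R 2)" for x y
    proof (cases "ennreal s < q (x + w) \<and> ennreal s < q (y + - w)")
      case True
      then have "ennreal s < min (q (x + w)) (q (y + - w))"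
        by simp
      also have "\<dots> \<le> q ((x + y) /\<^sub>R 2)"
        using q_quasiconcave[of "x + w" "y + - w"] by (simp add: algebra_simps)
      finally show ?thesis
        using True k_logconcave by simp
    qed auto
    then have "?I s w * ?I s (- w) \<le> ?I s 0 * ?I s 0"
      by (intro Prekopa_Leindler) auto
    also have "?I s (- w) = ?I s w"
    proof -
      have "?I s (- w) = (\<integral>\<^sup>+y. ?h (- w) (- y) \<partial>lborel)"
        by (rule nn_integral_lborel_uminus[symmetric]) measurable
      also have "\<dots> = ?I s w"
      proof (intro nn_integral_cong)
        fix y
        have "q (- y - w) = q (y + w)"
          using q_even[of "y + w"] by simp
        then show "?h (- w) (- y) = ?h w y"
          by (simp add: indicator_def k_even)
      qed
      finally show ?thesis .
    qed
    finally show ?thesis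
      by (simp only: ennreal_mult_self_le_iff)
  qed
  have layers: "(\<integral>\<^sup>+y. q (y + w) * k y \<partial>lborel) = (\<integral>\<^sup>+s. indicator {0<..} s * ?I s w \<partial>lborel)" for w
    by (rule nn_integral_mult_layer_cake) (simp_all add: sigma_finite_lborel)
  show ?thesis
    unfolding layers[of w] layers[of 0, simplified]
    by (intro nn_integral_mono mult_left_mono level[simplified]) auto
qed

section \<open>Gaussian weights and their precision matrix\<close>

definition quad :: "real ^ 'n ^ 'n \<Rightarrow> real ^ 'n \<Rightarrow> real" where
  "quad K z = z \<bullet> (K *v z)"

definition posdef :: "real ^ 'n ^ 'n \<Rightarrow> bool" where
  "posdef K \<longleftrightarrow> transpose K = K \<and> (\<forall>z. z \<noteq> 0 \<longrightarrow> 0 < quad K z)"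

lemma inner_symmetric_matrix:
  fixes K :: "real ^ 'n ^ 'n"
  assumes "transpose K = K"
  shows "x \<bullet> (K *v y) = y \<bullet> (K *v x)"
  by (metis assms dot_lmul_matrix inner_commute transpose_matrix_vector)

lemma quad_add:
  assumes "transpose K = K"
  shows "quad K (x + y) = quad K x + 2 * (x \<bullet> (K *v y)) + quad K y"
  using inner_symmetric_matrix[OF assms, of x y]
  by (simp add: quad_def matrix_vector_right_distrib inner_add_left inner_add_right)

lemma quad_scaleR: "quad K (t *\<^sub>R x) = t\<^sup>2 * quad K x"
  by (simp add: quad_def matrix_vector_mult_scaleR power2_eq_square)

lemma quad_uminus: "quad K (- x) = quad K x"
  using quad_scaleR[of K "-1" x] by simp

lemma quad_add_matrix: "quad (K + L) z = quad K z + quad L z"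
  by (simp add: quad_def matrix_vector_mult_add_rdistrib inner_add_right)

lemma posdef_psd: "posdef K \<Longrightarrow> psd K"
  by (auto simp: posdef_def psd_def quad_def) (metis inner_zero_left less_eq_real_def)

lemma posdef_add_psd: "posdef K \<Longrightarrow> psd D \<Longrightarrow> posdef (K + D)"
  by (auto simp: posdef_def psd_def quad_add_matrix transpose_def vec_eq_iff)
    (metis add_pos_nonneg quad_def)

lemma quad_midpoint:
  assumes "psd K"
  shows "quad K ((x + y) /\<^sub>R 2) \<le> (quad K x + quad K y) / 2"
proof -
  have sym: "transpose K = K" and nonneg: "0 \<le> quad K (x - y)"
    using assms by (auto simp: psd_def quad_def)
  have "quad K (x - y) = quad K x - 2 * (x \<bullet> (K *v y)) + quad K y"
    using quad_add[OF sym, of x "- y"] matrix_vector_mult_diff_distrib[of K 0 y]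
    by (simp add: quad_uminus)
  then show ?thesis
    using nonneg quad_add[OF sym, of x y] by (simp add: quad_scaleR power2_eq_square)
qed

lemma psd_Cauchy_Schwarz:
  assumes "psd D"
  shows "(x \<bullet> (D *v v))\<^sup>2 \<le> quad D x * quad D v"
proof -
  have sym: "transpose D = D" and nonneg: "0 \<le> quad D z" for z
    using assms by (auto simp: psd_def quad_def)
  let ?b = "x \<bullet> (D *v v)"
  have *: "0 \<le> quad D x + 2 * t * ?b + t\<^sup>2 * quad D v" for t
    using nonneg[of "x + t *\<^sub>R v"]
    by (simp add: quad_add[OF sym] quad_scaleR matrix_vector_mult_scaleR)
  show ?thesis
  proof (cases "quad D v = 0")
    case True
    have "?b = 0"
    proof (rule ccontr)
      assume "?b \<noteq> 0"
      then show False
        using *[of "- (quad D x + 1) / (2 * ?b)"] True by (simp add: field_simps)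
    qed
    with True show ?thesis by simp
  next
    case False
    then have "0 < quad D v"
      using nonneg[of v] by simp
    then show ?thesis
      using *[of "- ?b / quad D v"] by (simp add: field_simps power2_eq_square)
  qed
qed

definition outer :: "real ^ 'n \<Rightarrow> real ^ 'n \<Rightarrow> real ^ 'n ^ 'n" where
  "outer x y = (\<chi> i j. x $ i * y $ j)"

lemma outer_mult: "outer x y *v z = (y \<bullet> z) *\<^sub>R x"
  by (simp add: outer_def matrix_vector_mult_def vec_eq_iff inner_vec_def sum_distrib_left ac_simps)

lemma quad_outer: "quad (outer w w) z = (w \<bullet> z)\<^sup>2"
  by (simp add: quad_def outer_mult power2_eq_square inner_commute)

lemma transpose_outer: "transpose (outer w w) = outer w w"
  by (simp add: outer_def transpose_def vec_eq_iff)

lemma matrix_mult_outer: "A ** outer x y = outer (A *v x) y"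
  by (simp add: outer_def matrix_matrix_mult_def matrix_vector_mult_def vec_eq_iff sum_distrib_right sum_distrib_left ac_simps)

lemma outer_mult_matrix: "outer x y ** A = outer x (transpose A *v y)"
  by (simp add: outer_def matrix_matrix_mult_def matrix_vector_mult_def transpose_def vec_eq_iff sum_distrib_left ac_simps)

lemma matrix_add_rdistrib: "(A + B) ** C = A ** C + B ** (C :: real ^ 'm ^ 'n)"
  by (simp add: matrix_matrix_mult_def vec_eq_iff distrib_right sum.distrib)

lemma det_mat_add_outer_axis:
  fixes x :: "real ^ 'n"
  shows "det (mat 1 + outer x (axis k c)) = 1 + c * x $ k"
proof -
  let ?v = "axis k 1 + c *\<^sub>R x"
  have "mat 1 + outer x (axis k c) = (\<chi> i j. if j = k then (mat 1 *v ?v) $ i else mat 1 $ i $ j)"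
    unfolding matrix_vector_mul_lid by (simp add: vec_eq_iff outer_def mat_def axis_def)
  then show ?thesis
    using cramer_lemma[where A="mat 1" and x="?v" and k=k] by (simp add: axis_def)
qed

lemma det_mat_add_outer:
  fixes x y :: "real ^ 'n"
  shows "det (mat 1 + outer x y) = 1 + x \<bullet> y"
proof -
  fix k :: 'n
  have "norm (axis k (norm y)) = norm y"
    by (simp add: norm_eq_sqrt_inner inner_axis_axis)
  then obtain Q where Q: "orthogonal_transformation Q" "Q y = axis k (norm y)"
    using orthogonal_transformation_exists[of y "axis k (norm y)"] by metis
  define A where "A = matrix Q"
  have A: "orthogonal_matrix A" "A *v z = Q z" for z
    using Q(1) by (auto simp: A_def orthogonal_transformation_matrix matrix_works)
  have AA: "A ** transpose A = mat 1"
    using A(1) by (simp add: orthogonal_matrix_def)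
  then have detA: "det A * det (transpose A) = 1"
    by (metis det_mul det_I)
  have "det (mat 1 + outer x y) = det A * det (mat 1 + outer x y) * det (transpose A)"
    using detA by simp
  also have "\<dots> = det (A ** (mat 1 + outer x y) ** transpose A)"
    by (simp add: det_mul)
  also have "A ** (mat 1 + outer x y) ** transpose A = mat 1 + outer (Q x) (Q y)"
    by (simp add: matrix_add_ldistrib matrix_add_rdistrib AA matrix_mult_outer outer_mult_matrix A)
  also have "det \<dots> = 1 + Q x \<bullet> Q y"
    unfolding Q(2) det_mat_add_outer_axis by (simp add: inner_axis mult.commute)
  also have "Q x \<bullet> Q y = x \<bullet> y"
    using Q(1) by (simp add: orthogonal_transformation_def)
  finally show ?thesis .
qed

lemma posdef_surj:
  assumes "posdef K"
  obtains u where "K *v u = w"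
proof -
  have "x = 0" if "K *v x = 0" for x
    using assms that by (force simp: posdef_def quad_def)
  then obtain B where "B ** K = mat 1"
    using matrix_left_invertible_ker[of K] by blast
  then have "K ** B = mat 1"
    by (simp add: matrix_left_right_inverse)
  then have "K *v (B *v w) = w"
    by (simp add: matrix_vector_mul_assoc)
  then show ?thesis ..
qed

lemma borel_measurable_quad [measurable]: "quad K \<in> borel_measurable borel"
  unfolding quad_def
  by (intro borel_measurable_continuous_onI continuous_intros linear_continuous_on_compose[OF continuous_on_id] matrix_vector_mul_linear)

definition gauss_weight :: "real ^ 'n ^ 'n \<Rightarrow> real ^ 'n \<Rightarrow> ennreal" where
  "gauss_weight K z = ennreal (exp (- quad K z / 2))"

lemma borel_measurable_gauss_weight [measurable]: "gauss_weight K \<in> borel_measurable borel"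
  unfolding gauss_weight_def by measurable

lemma nn_integral_normal_density: "0 < \<sigma> \<Longrightarrow> (\<integral>\<^sup>+x. ennreal (normal_density \<mu> \<sigma> x) \<partial>lborel) = 1"
  using prob_space.emeasure_space_1[OF prob_space_normal_density, of \<sigma> \<mu>]
  by (simp add: emeasure_density)

text \<open>The factor \<open>exp ((w \<bullet> z)\<^sup>2 / 2)\<close> by which the two Gaussian weights differ is the average of
  \<open>exp (t * (w \<bullet> z))\<close> over a standard normal \<open>t\<close>; so the wider Gaussian is a mixture of translates of
  the narrower one, and Anderson's inequality applies to each translate.\<close>

lemma gauss_weight_rank_one_mono:
  fixes q :: "real ^ 'n \<Rightarrow> ennreal"
  assumes [measurable]: "q \<in> borel_measurable borel"
    and q_even: "\<And>x. q (- x) = q x"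
    and q_quasiconcave: "\<And>x y. min (q x) (q y) \<le> q ((x + y) /\<^sub>R 2)"
    and K: "posdef K" and L: "L = K + outer w w"
  shows "ennreal (sqrt (det K)) * (\<integral>\<^sup>+z. q z * gauss_weight K z \<partial>lborel)
    \<le> ennreal (sqrt (det L)) * (\<integral>\<^sup>+z. q z * gauss_weight L z \<partial>lborel)"
proof -
  have "psd (outer w w)"
    by (simp add: psd_def transpose_outer flip: quad_def) (simp add: quad_outer)
  then have posL: "posdef L"
    unfolding L using K by (rule posdef_add_psd[rotated])
  then have symL: "transpose L = L"
    by (simp add: posdef_def)
  obtain u where u: "L *v u = w"
    using posdef_surj[OF posL] .
  define a where "a = w \<bullet> u"
  have quad_u: "quad L u = a"
    by (simp add: quad_def u a_def inner_commute)
  have quadK: "quad K z = quad L z - (w \<bullet> z)\<^sup>2" for z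
    by (simp add: L quad_add_matrix quad_outer)
  have a1: "a < 1"
  proof (cases "u = 0")
    case False
    then have "0 < a - a\<^sup>2" "0 < a"
      using K posL by (auto simp: posdef_def quadK quad_u a_def[symmetric] simp flip: quad_u)
    then have "0 < a * (1 - a)"
      by (simp add: power2_eq_square algebra_simps)
    with \<open>0 < a\<close> show ?thesis
      by (simp add: zero_less_mult_iff)
  qed (simp add: a_def)
  define s where "s = 1 / sqrt (1 - a)"
  have s: "0 < s"
    using a1 by (simp add: s_def)
  have detK: "det K = det L * (1 - a)"
  proof -
    have "K = L ** (mat 1 + outer (- u) w)"
      using matrix_vector_mult_diff_distrib[of L 0 u]
      by (simp add: matrix_add_ldistrib matrix_mult_outer u) (simp add: L outer_def vec_eq_iff)
    then show ?thesis
      by (simp add: det_mul det_mat_add_outer a_def inner_commute)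
  qed
  let ?J = "\<integral>\<^sup>+z. q z * gauss_weight L z \<partial>lborel"
  have mixture: "gauss_weight K z
      = (\<integral>\<^sup>+t. gauss_weight L z * ennreal (std_normal_density t * exp (t * (w \<bullet> z))) \<partial>lborel)" for z
  proof -
    have "std_normal_density t * exp (t * m) = exp (m\<^sup>2 / 2) * normal_density m 1 t" for t m
      by (simp add: normal_density_def exp_add[symmetric] exp_diff[symmetric] power2_eq_square)
        (simp add: field_simps)
    then have "(\<integral>\<^sup>+t. gauss_weight L z * ennreal (std_normal_density t * exp (t * (w \<bullet> z))) \<partial>lborel)
        = gauss_weight L z * (ennreal (exp ((w \<bullet> z)\<^sup>2 / 2)) * (\<integral>\<^sup>+t. ennreal (normal_density (w \<bullet> z) 1 t) \<partial>lborel))"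
      by (simp add: nn_integral_cmult ennreal_mult)
    also have "\<dots> = gauss_weight K z"
      by (simp add: nn_integral_normal_density gauss_weight_def quadK ennreal_mult[symmetric]
          exp_add[symmetric] diff_divide_distrib)
    finally show ?thesis ..
  qed
  have translate: "gauss_weight L (t *\<^sub>R u + y) * ennreal (std_normal_density t * exp (t * (w \<bullet> (t *\<^sub>R u + y))))
      = gauss_weight L y * ennreal (s * normal_density 0 s t)" for t y
  proof -
    have "y \<bullet> (L *v u) = w \<bullet> y"
      by (simp add: u inner_commute)
    then have "quad L (t *\<^sub>R u + y) = t\<^sup>2 * a + 2 * t * (w \<bullet> y) + quad L y"
      using inner_symmetric_matrix[OF symL, of u y]
      by (simp add: quad_add[OF symL] quad_scaleR quad_u)
    then have "exp (- quad L (t *\<^sub>R u + y) / 2) * (std_normal_density t * exp (t * (w \<bullet> (t *\<^sub>R u + y))))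
        = exp (- quad L y / 2) * (1 / sqrt (2 * pi) * exp (- (1 - a) * t\<^sup>2 / 2))"
      by (simp add: std_normal_density_def exp_add[symmetric] inner_add_right a_def[symmetric])
        (simp add: field_simps power2_eq_square)
    also have "1 / sqrt (2 * pi) * exp (- (1 - a) * t\<^sup>2 / 2) = s * normal_density 0 s t"
    proof -
      have "t\<^sup>2 / (2 * s\<^sup>2) = (1 - a) * t\<^sup>2 / 2"
        using a1 by (simp add: s_def power_divide)
      then have "- t\<^sup>2 / (2 * s\<^sup>2) = - (1 - a) * t\<^sup>2 / 2"
        by (simp add: algebra_simps)
      then show ?thesis
        using s unfolding normal_density_def by (simp only: diff_zero) (simp add: real_sqrt_mult)
    qed
    finally show ?thesis
      using s by (simp add: gauss_weight_def ennreal_mult[symmetric])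
  qed
  have anderson: "(\<integral>\<^sup>+y. q (y + v) * gauss_weight L y \<partial>lborel) \<le> ?J" for v
  proof (rule Anderson)
    show "gauss_weight L (- x) = gauss_weight L x" for x
      by (simp add: gauss_weight_def quad_uminus)
    show "gauss_weight L x * gauss_weight L y
        \<le> gauss_weight L ((x + y) /\<^sub>R 2) * gauss_weight L ((x + y) /\<^sub>R 2)" for x y
      using quad_midpoint[OF posdef_psd[OF posL], of x y]
      by (simp add: gauss_weight_def ennreal_mult[symmetric] exp_add[symmetric] field_simps)
  qed (use assms in auto)
  have "(\<integral>\<^sup>+z. q z * gauss_weight K z \<partial>lborel)
      = (\<integral>\<^sup>+z. (\<integral>\<^sup>+t. q z * (gauss_weight L z * ennreal (std_normal_density t * exp (t * (w \<bullet> z)))) \<partial>lborel) \<partial>lborel)"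
    unfolding mixture by (intro nn_integral_cong nn_integral_cmult[symmetric]) measurable
  also have "\<dots> = (\<integral>\<^sup>+t. (\<integral>\<^sup>+z. q z * (gauss_weight L z * ennreal (std_normal_density t * exp (t * (w \<bullet> z)))) \<partial>lborel) \<partial>lborel)"
    by (rule pair_sigma_finite.Fubini'[symmetric]) (auto simp: pair_sigma_finite_def sigma_finite_lborel)
  also have "\<dots> = (\<integral>\<^sup>+t. ennreal (s * normal_density 0 s t) * (\<integral>\<^sup>+y. q (y + t *\<^sub>R u) * gauss_weight L y \<partial>lborel) \<partial>lborel)"
  proof (intro nn_integral_cong)
    fix t :: real
    have "(\<integral>\<^sup>+z. q z * (gauss_weight L z * ennreal (std_normal_density t * exp (t * (w \<bullet> z)))) \<partial>lborel)
        = (\<integral>\<^sup>+y. q (t *\<^sub>R u + y) * (gauss_weight L y * ennreal (s * normal_density 0 s t)) \<partial>lborel)"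
      unfolding translate[symmetric] by (rule nn_integral_lborel_translation[symmetric]) measurable
    also have "\<dots> = (\<integral>\<^sup>+y. ennreal (s * normal_density 0 s t) * (q (y + t *\<^sub>R u) * gauss_weight L y) \<partial>lborel)"
      by (simp add: ac_simps)
    also have "\<dots> = ennreal (s * normal_density 0 s t) * (\<integral>\<^sup>+y. q (y + t *\<^sub>R u) * gauss_weight L y \<partial>lborel)"
      by (rule nn_integral_cmult) measurable
    finally show "(\<integral>\<^sup>+z. q z * (gauss_weight L z * ennreal (std_normal_density t * exp (t * (w \<bullet> z)))) \<partial>lborel) = \<dots>" .
  qed
  also have "\<dots> \<le> (\<integral>\<^sup>+t. ennreal (s * normal_density 0 s t) * ?J \<partial>lborel)"
    by (intro nn_integral_mono mult_left_mono anderson) auto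
  also have "\<dots> = ennreal s * ?J"
    using s by (simp add: nn_integral_multc nn_integral_cmult ennreal_mult nn_integral_normal_density)
  finally have "ennreal (sqrt (det K)) * (\<integral>\<^sup>+z. q z * gauss_weight K z \<partial>lborel)
      \<le> ennreal (sqrt (det K)) * (ennreal s * ?J)"
    by (rule mult_left_mono) simp
  also have "\<dots> = ennreal (sqrt (det L)) * ?J"
  proof -
    have "sqrt (det L) = sqrt (det K) * s"
      using a1 by (simp add: detK s_def real_sqrt_mult)
    then show ?thesis
      using s by (simp add: ennreal_mult'' mult.assoc)
  qed
  finally show ?thesis .
qed

lemma psd_decomposition_induct [consumes 1, case_names zero add]:
  fixes D :: "real ^ 'n ^ 'n"
  assumes "psd D" and zero: "P 0"
    and add: "\<And>D w. psd D \<Longrightarrow> P D \<Longrightarrow> P (D + outer w w)"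
  shows "P D"
  using \<open>psd D\<close>
proof (induction "CARD('n) - dim {x. D *v x = 0}" arbitrary: D rule: less_induct)
  case less
  have sub: "subspace {x. M *v x = 0}" for M :: "real ^ 'n ^ 'n"
    by (simp add: subspace_def matrix_vector_right_distrib matrix_vector_mult_scaleR)
  show ?case
  proof (cases "\<exists>v. quad D v \<noteq> 0")
    case False
    have "D *v x = 0" for x
      using psd_Cauchy_Schwarz[OF less.prems, of "D *v x" x] False by simp
    then have "D = 0"
      by (simp add: matrix_eq)
    with zero show ?thesis by simp
  next
    case True
    have sym: "transpose D = D" and nonneg: "0 \<le> quad D z" for z
      using less.prems by (auto simp: psd_def quad_def)
    from True nonneg obtain v where v: "0 < quad D v"
      by (metis less_eq_real_def)
    define w where "w = (1 / sqrt (quad D v)) *\<^sub>R (D *v v)"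
    define D' where "D' = D - outer w w"
    have D: "D = D' + outer w w"
      by (simp add: D'_def)
    have D'_mult: "D' *v x = D *v x - (w \<bullet> x) *\<^sub>R w" for x
      by (simp add: D'_def matrix_vector_mult_diff_rdistrib outer_mult)
    have w_inner: "w \<bullet> x = (x \<bullet> (D *v v)) / sqrt (quad D v)" for x
      by (simp add: w_def inner_commute)
    have "quad D' x = quad D x - (w \<bullet> x)\<^sup>2" for x
      by (simp add: quad_def D'_mult inner_diff_right inner_commute[of x w] power2_eq_square)
    moreover have "(w \<bullet> x)\<^sup>2 = (x \<bullet> (D *v v))\<^sup>2 / quad D v" for x
      using v by (simp add: w_inner power_divide)
    ultimately have "quad D' x = quad D x - (x \<bullet> (D *v v))\<^sup>2 / quad D v" for x
      by simp
    then have "0 \<le> quad D' x" for x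
      using psd_Cauchy_Schwarz[OF less.prems, of x v] v by (simp add: pos_divide_le_eq)
    moreover have "transpose D' = D'"
      using sym by (simp add: D'_def transpose_def vec_eq_iff outer_def)
    ultimately have psd': "psd D'"
      by (simp add: psd_def quad_def)
    have "{x. D *v x = 0} \<subset> {x. D' *v x = 0}"
    proof
      show "{x. D *v x = 0} \<subseteq> {x. D' *v x = 0}"
      proof clarify
        fix x assume x: "D *v x = 0"
        then have "x \<bullet> (D *v v) = 0"
          using inner_symmetric_matrix[OF sym, of x v] by simp
        with x show "D' *v x = 0"
          by (simp add: D'_mult w_inner)
      qed
      have "D' *v v = 0" "D *v v \<noteq> 0"
        using v by (auto simp: D'_mult w_inner quad_def) (auto simp: w_def quad_def)
      then show "{x. D *v x = 0} \<noteq> {x. D' *v x = 0}"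
        by auto
    qed
    then have "dim {x. D *v x = 0} < dim {x. D' *v x = 0}"
      using sub by (intro dim_psubset) (simp add: span_eq_iff[THEN iffD2])
    moreover have "dim {x. D' *v x = 0} \<le> CARD('n)"
      using dim_subset_UNIV[of "{x. D' *v x = 0}"] by simp
    ultimately have "P D'"
      by (intro less.hyps psd') simp
    then show ?thesis
      unfolding D by (rule add[OF psd'])
  qed
qed

lemma gauss_weight_mono:
  fixes q :: "real ^ 'n \<Rightarrow> ennreal"
  assumes "q \<in> borel_measurable borel"
    and "\<And>x. q (- x) = q x"
    and "\<And>x y. min (q x) (q y) \<le> q ((x + y) /\<^sub>R 2)"
    and K: "posdef K" and D: "psd D"
  shows "ennreal (sqrt (det K)) * (\<integral>\<^sup>+z. q z * gauss_weight K z \<partial>lborel)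
    \<le> ennreal (sqrt (det (K + D))) * (\<integral>\<^sup>+z. q z * gauss_weight (K + D) z \<partial>lborel)"
  using D
proof (induction rule: psd_decomposition_induct)
  case (add D w)
  then show ?case
    using gauss_weight_rank_one_mono[OF assms(1-3) posdef_add_psd[OF K add(1)], of "K + (D + outer w w)" w]
    by (simp add: add.assoc)
qed simp

lemma posdef_det_pos:
  fixes K :: "real ^ 'n ^ 'n"
  assumes K: "posdef K"
  shows "0 < det K"
proof (rule ccontr)
  assume "\<not> 0 < det K"
  let ?M = "\<lambda>t. (1 - t) *\<^sub>R mat 1 + t *\<^sub>R K"
  have "continuous_on {0..1} (\<lambda>t. det (?M t))"
    unfolding det_def by (intro continuous_intros)
  with \<open>\<not> 0 < det K\<close> obtain t where t: "0 \<le> t" "t \<le> 1" "det (?M t) = 0"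
    using IVT2'[of "\<lambda>t. det (?M t)" 1 0 0] by auto
  then have "\<not> invertible (?M t)"
    by (simp add: invertible_det_nz)
  then obtain x where x: "x \<noteq> 0" "?M t *v x = 0"
    by (auto simp: invertible_left_inverse matrix_left_invertible_ker)
  have "x \<bullet> (?M t *v x) = (1 - t) * (norm x)\<^sup>2 + t * quad K x"
    by (simp add: matrix_vector_mult_add_rdistrib inner_add_right quad_def power2_norm_eq_inner
        scaleR_matrix_vector_assoc[symmetric])
  moreover have "0 < (1 - t) * (norm x)\<^sup>2 + t * quad K x"
  proof (cases "t = 0")
    case False
    with t x K show ?thesis
      by (intro add_nonneg_pos) (auto simp: posdef_def)
  qed (use x in simp)
  ultimately show False
    using x by simp
qed

lemma posdef_coercive:
  fixes K :: "real ^ 'n ^ 'n"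
  assumes K: "posdef K"
  obtains m where "0 < m" "\<And>z. m * (norm z)\<^sup>2 \<le> quad K z"
proof -
  have "continuous_on (sphere 0 1) (quad K)"
    unfolding quad_def
    by (intro continuous_intros linear_continuous_on_compose[OF continuous_on_id] matrix_vector_mul_linear)
  moreover have "sphere (0 :: real ^ 'n) 1 \<noteq> {}"
    by simp
  ultimately obtain e where e: "e \<in> sphere 0 1" "\<And>z. z \<in> sphere 0 1 \<Longrightarrow> quad K e \<le> quad K z"
    using continuous_attains_inf[of "sphere 0 1" "quad K"] by auto
  show ?thesis
  proof
    show "0 < quad K e"
    proof -
      have "e \<noteq> 0"
        using e(1) by auto
      with K show ?thesis
        by (simp add: posdef_def)
    qed
    fix z :: "real ^ 'n"
    show "quad K e * (norm z)\<^sup>2 \<le> quad K z"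
    proof (cases "z = 0")
      case False
      then have "quad K e \<le> quad K ((1 / norm z) *\<^sub>R z)"
        by (intro e(2)) simp
      with False show ?thesis
        by (simp add: quad_scaleR power_divide field_simps)
    qed (simp add: quad_def)
  qed
qed

lemma nn_integral_gauss_weight_finite:
  assumes "posdef K"
  shows "(\<integral>\<^sup>+z. gauss_weight K z \<partial>lborel) < top"
proof -
  obtain m where m: "0 < m" "\<And>z. m * (norm z)\<^sup>2 \<le> quad K z"
    using posdef_coercive[OF assms] by blast
  let ?k = "\<lambda>x::real. ennreal (exp (- m * x\<^sup>2 / 2))"
  have "gauss_weight K z \<le> (\<Prod>b\<in>Basis. ?k (z \<bullet> b))" for z
  proof -
    have "(norm z)\<^sup>2 = (\<Sum>b\<in>Basis. (z \<bullet> b)\<^sup>2)"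
      by (simp add: norm_eq_sqrt_inner euclidean_inner[of z z] power2_eq_square sum_nonneg)
    then have "(\<Sum>b\<in>Basis. - m * (z \<bullet> b)\<^sup>2 / 2) = - m * (norm z)\<^sup>2 / 2"
      by (simp add: sum_distrib_left sum_divide_distrib sum_negf)
    then show ?thesis
      using m(2)[of z] by (simp add: gauss_weight_def prod_ennreal exp_sum[symmetric])
  qed
  then have "(\<integral>\<^sup>+z. gauss_weight K z \<partial>lborel) \<le> (\<integral>\<^sup>+z. (\<Prod>b\<in>(Basis :: (real ^ 'a) set). ?k (z \<bullet> b)) \<partial>lborel)"
    by (intro nn_integral_mono)
  also have "\<dots> = (\<Prod>b\<in>(Basis :: (real ^ 'a) set). (\<integral>\<^sup>+x. ?k x \<partial>lborel))"
    by (rule nn_integral_lborel_prod) auto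
  also have "\<dots> < top"
  proof -
    have "exp (- m * x\<^sup>2 / 2) = sqrt (2 * pi / m) * normal_density 0 (1 / sqrt m) x" for x
      using m(1) by (simp add: normal_density_def real_sqrt_mult real_sqrt_divide power_divide)
    then have "(\<integral>\<^sup>+x. ?k x \<partial>lborel) = ennreal (sqrt (2 * pi / m)) * (\<integral>\<^sup>+x. normal_density 0 (1 / sqrt m) x \<partial>lborel)"
      using m(1) by (simp add: ennreal_mult nn_integral_cmult)
    also have "\<dots> < top"
      using m(1) by (simp add: nn_integral_normal_density)
    finally show ?thesis
      by (simp add: power_less_top_ennreal)
  qed
  finally show ?thesis .
qed

section \<open>The bound on the normalizing factor\<close>

lemma ennreal_inverse_antimono:
  fixes a b :: ennreal
  assumes "a \<le> b"
  shows "inverse b \<le> inverse a"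
  including ennreal.lifting
  using assms by transfer (simp add: ereal_inverse_antimono)

lemma eexp_infinity [simp]: "eexp \<infinity> = top" "eexp (- \<infinity>) = 0"
  unfolding infinity_ereal_def uminus_ereal.simps eexp.simps by simp_all

lemma eexp_uminus_plus:
  "a \<noteq> -\<infinity> \<Longrightarrow> b \<noteq> -\<infinity> \<Longrightarrow> eexp (- (a + b)) = eexp (- a) * eexp (- b)"
  by (cases a; cases b) (simp_all add: ennreal_mult[symmetric] exp_add[symmetric])

lemma eexp_mono: "a \<le> b \<Longrightarrow> eexp a \<le> eexp b"
  by (cases a; cases b) simp_all

lemma borel_measurable_eexp [measurable]: "eexp \<in> borel_measurable borel"
proof -
  have "eexp = (\<lambda>x. if x = \<infinity> then top else if x = -\<infinity> then 0 else ennreal (exp (real_of_ereal x)))"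
  proof
    show "eexp x = (if x = \<infinity> then top else if x = -\<infinity> then 0 else ennreal (exp (real_of_ereal x)))" for x
      by (cases x) simp_all
  qed
  also have "\<dots> \<in> borel_measurable borel"
    by measurable
  finally show ?thesis .
qed

lemma borel_measurable_mono_ennreal:
  fixes r :: "real \<Rightarrow> ennreal"
  assumes "mono r"
  shows "r \<in> borel_measurable borel"
proof (rule borel_measurableI_less)
  fix y
  have "is_interval {x. r x < y}"
    unfolding is_interval_1 using monoD[OF assms] by (auto intro: le_less_trans)
  then show "{x \<in> space borel. r x < y} \<in> sets borel"
    by (simp add: real_interval_borel_measurable)
qed

lemma penalty_not_minfty:
  assumes "\<And>j \<theta>. g j \<theta> \<noteq> -\<infinity>" and "\<And>j. 0 \<le> lam $ j"
  shows "penalty g lam \<theta> \<noteq> -\<infinity>"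
proof -
  have "ereal (lam $ j) * g j \<theta> \<noteq> -\<infinity>" for j
    using assms(1)[of j \<theta>] assms(2)[of j] by (cases "g j \<theta>") (auto simp: zero_less_mult_iff)
  then have "(\<Sum>j\<in>J. ereal (lam $ j) * g j \<theta>) \<noteq> -\<infinity>" for J
    by (induction J rule: infinite_finite_induct) auto
  then show ?thesis
    by (simp add: penalty_def)
qed

lemma penalty_upper_bound:
  assumes lam: "\<And>j. 0 \<le> lam $ j"
    and g: "\<And>j. g j \<psi> \<le> g j \<theta> + ereal (B j)"
  shows "penalty g lam \<psi> \<le> penalty g lam \<theta> + ereal (\<Sum>j\<in>UNIV. lam $ j * B j)"
proof -
  have "ereal (lam $ j) * g j \<psi> \<le> ereal (lam $ j) * g j \<theta> + ereal (lam $ j * B j)" for j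
  proof -
    have "ereal (lam $ j) * g j \<psi> \<le> ereal (lam $ j) * (g j \<theta> + ereal (B j))"
      using lam by (intro ereal_mult_left_mono g) simp
    also have "\<dots> = ereal (lam $ j) * g j \<theta> + ereal (lam $ j * B j)"
      by (cases "g j \<theta>") (auto simp: distrib_left)
    finally show ?thesis .
  qed
  then have "penalty g lam \<psi> \<le> (\<Sum>j\<in>UNIV. ereal (lam $ j) * g j \<theta> + ereal (lam $ j * B j))"
    unfolding penalty_def by (rule sum_mono)
  then show ?thesis
    by (simp add: penalty_def sum.distrib)
qed

lemma quad_sum_scaleR:
  "quad (\<Sum>j\<in>J. a j *\<^sub>R H j) z = (\<Sum>j\<in>J. a j * quad (H j) z)"
proof (induction J rule: infinite_finite_induct)
  case (insert j J)
  then show ?case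
    by (simp add: quad_add_matrix) (simp add: quad_def scaleR_matrix_vector_assoc[symmetric])
qed (simp_all add: quad_def)

lemma psd_sum_scaleR:
  assumes "\<And>j. j \<in> J \<Longrightarrow> 0 \<le> a j" "\<And>j. j \<in> J \<Longrightarrow> psd (H j)"
  shows "psd (\<Sum>j\<in>J. a j *\<^sub>R H j)"
proof -
  have "0 \<le> quad (\<Sum>j\<in>J. a j *\<^sub>R H j) z" for z
    unfolding quad_sum_scaleR using assms
    by (intro sum_nonneg mult_nonneg_nonneg) (auto simp: psd_def quad_def)
  moreover have "H j $ k $ i = H j $ i $ k" if "j \<in> J" for j i k
    using assms(2)[OF that] by (simp add: psd_def transpose_def vec_eq_iff)
  then have "transpose (\<Sum>j\<in>J. a j *\<^sub>R H j) = (\<Sum>j\<in>J. a j *\<^sub>R H j)"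
    by (simp add: transpose_def vec_eq_iff)
  ultimately show ?thesis
    by (simp add: psd_def quad_def)
qed

lemma psd_invertible_posdef:
  assumes "psd H" "invertible H"
  shows "posdef H"
  unfolding posdef_def
proof (intro conjI allI impI)
  show "transpose H = H"
    using assms(1) by (simp add: psd_def)
  fix z :: "real ^ 'a" assume z: "z \<noteq> 0"
  have "quad H z \<noteq> 0"
  proof
    assume "quad H z = 0"
    then have "H *v z = 0"
      using psd_Cauchy_Schwarz[OF assms(1), of "H *v z" z] by simp
    with z assms(2) show False
      by (auto simp: invertible_left_inverse matrix_left_invertible_ker)
  qed
  then show "0 < quad H z"
    using assms(1) by (simp add: psd_def quad_def less_le)
qed

lemma matrix_inv_unique:
  assumes "A ** B = mat 1" "B ** A = mat 1"
  shows "matrix_inv A = B"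
proof -
  have "A ** matrix_inv A = mat 1 \<and> matrix_inv A ** A = mat 1"
    unfolding matrix_inv_def by (rule someI[of _ B]) (use assms in simp)
  then show ?thesis
    by (metis assms(2) matrix_mul_assoc matrix_mul_lid matrix_mul_rid)
qed

text \<open>A convex set need not be a Borel set, so integrals over \<open>U\<close> are only lower integrals; replacing \<open>U\<close>
  by its interior restores measurability and loses only the frontier, a null set.\<close>

lemma AE_indicator_interior_convex:
  fixes U :: "'a::euclidean_space set"
  assumes "convex U"
  shows "AE z in lborel. indicator U z = (indicator (interior U) z :: ennreal)"
proof -
  have "frontier U \<in> null_sets lebesgue"
    using negligible_convex_frontier[OF assms] by (simp add: negligible_iff_null_sets)
  then have "frontier U \<in> null_sets lborel"
    by (subst (asm) null_sets_completion_iff) auto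
  then have "AE z in lborel. z \<notin> frontier U"
    by (rule AE_not_in)
  then show ?thesis
  proof eventually_elim
    case (elim z)
    then show ?case
      using interior_subset[of U] closure_subset[of U] by (auto simp: frontier_def indicator_def)
  qed
qed

lemma nn_integral_exp_even_ge:
  fixes k :: "'a::euclidean_space \<Rightarrow> ennreal"
  assumes [measurable]: "k \<in> borel_measurable borel" and even: "\<And>z. k (- z) = k z"
  shows "(\<integral>\<^sup>+z. k z \<partial>lborel) \<le> (\<integral>\<^sup>+z. ennreal (exp (\<xi> \<bullet> z)) * k z \<partial>lborel)"
proof -
  let ?E = "\<integral>\<^sup>+z. ennreal (exp (\<xi> \<bullet> z)) * k z \<partial>lborel"
  have cosh: "2 \<le> exp t + exp (- t)" for t :: real
  proof -
    have "1 \<le> cosh t" by (rule cosh_real_ge_1)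
    then show ?thesis by (simp add: cosh_field_def)
  qed
  have "2 * (\<integral>\<^sup>+z. k z \<partial>lborel) = (\<integral>\<^sup>+z. 2 * k z \<partial>lborel)"
    by (simp add: nn_integral_cmult)
  also have "\<dots> \<le> (\<integral>\<^sup>+z. ennreal (exp (\<xi> \<bullet> z)) * k z + ennreal (exp (- (\<xi> \<bullet> z))) * k z \<partial>lborel)"
  proof (rule nn_integral_mono)
    fix z
    have "ennreal 2 * k z \<le> ennreal (exp (\<xi> \<bullet> z) + exp (- (\<xi> \<bullet> z))) * k z"
      by (intro mult_right_mono ennreal_leI cosh) simp
    then show "2 * k z \<le> ennreal (exp (\<xi> \<bullet> z)) * k z + ennreal (exp (- (\<xi> \<bullet> z))) * k z"
      by (simp add: distrib_right)
  qed
  also have "\<dots> = ?E + (\<integral>\<^sup>+z. ennreal (exp (- (\<xi> \<bullet> z))) * k z \<partial>lborel)"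
    by (rule nn_integral_add) measurable
  also have "(\<integral>\<^sup>+z. ennreal (exp (- (\<xi> \<bullet> z))) * k z \<partial>lborel) = ?E"
    using nn_integral_lborel_uminus[of "\<lambda>z. ennreal (exp (\<xi> \<bullet> z)) * k z"] by (simp add: even)
  also have "?E + ?E = 2 * ?E"
    by (simp add: mult_2)
  finally show ?thesis
    by (subst (asm) ennreal_mult_le_mult_iff) auto
qed

definition remainder_weight :: "(real \<Rightarrow> ennreal) \<Rightarrow> (real ^ 'n) set \<Rightarrow> real ^ 'n \<Rightarrow> ennreal" where
  "remainder_weight r V z = indicator V z * eexp (- enn2ereal (r ((norm z)\<^sup>2)))"

lemma borel_measurable_remainder_weight:
  assumes "mono r" and [measurable]: "V \<in> sets borel"
  shows "remainder_weight r V \<in> borel_measurable borel"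
proof -
  note borel_measurable_mono_ennreal[OF assms(1), measurable]
  show ?thesis
    unfolding remainder_weight_def by measurable
qed

lemma remainder_weight_even:
  "uminus ` V = V \<Longrightarrow> remainder_weight r V (- z) = remainder_weight r V z"
  by (auto simp: remainder_weight_def indicator_def) (metis image_eqI minus_minus)+

lemma remainder_weight_quasiconcave:
  assumes "mono r" "convex V"
  shows "min (remainder_weight r V x) (remainder_weight r V y) \<le> remainder_weight r V ((x + y) /\<^sub>R 2)"
proof (cases "x \<in> V \<and> y \<in> V")
  case True
  then have "(1/2) *\<^sub>R x + (1/2) *\<^sub>R y \<in> V"
    by (intro convexD[OF assms(2)]) auto
  then have mid: "(x + y) /\<^sub>R 2 \<in> V"
    by (simp add: scaleR_add_right inverse_eq_divide)
  have *: "remainder_weight r V z \<le> remainder_weight r V ((x + y) /\<^sub>R 2)"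
    if "norm ((x + y) /\<^sub>R 2) \<le> norm z" for z
  proof -
    have "r ((norm ((x + y) /\<^sub>R 2))\<^sup>2) \<le> r ((norm z)\<^sup>2)"
      using that by (intro monoD[OF assms(1)] power_mono) auto
    then have "eexp (- enn2ereal (r ((norm z)\<^sup>2))) \<le> eexp (- enn2ereal (r ((norm ((x + y) /\<^sub>R 2))\<^sup>2)))"
      by (intro eexp_mono) (simp add: less_eq_ennreal.rep_eq)
    with mid show ?thesis
      by (cases "z \<in> V") (simp_all add: remainder_weight_def)
  qed
  have "norm ((x + y) /\<^sub>R 2) \<le> norm x \<or> norm ((x + y) /\<^sub>R 2) \<le> norm y"
    using norm_triangle_ineq[of x y] by auto
  then show ?thesis
    using * by (auto simp: min_le_iff_disj)
qed (auto simp: remainder_weight_def)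

lemma remainder_weight_integral_pos:
  assumes r: "mono r" "((\<lambda>t::real. r (t\<^sup>2) / ennreal (t\<^sup>2)) \<longlongrightarrow> 0) (at 0)"
    and V: "open V" "0 \<in> V"
  shows "0 < (\<integral>\<^sup>+z. remainder_weight r V z * gauss_weight K z \<partial>lborel)"
proof (rule ccontr)
  note borel_measurable_remainder_weight[OF r(1) borel_open[OF V(1)], measurable]
  assume "\<not> ?thesis"
  then have "(\<integral>\<^sup>+z. remainder_weight r V z * gauss_weight K z \<partial>lborel) = 0"
    by simp
  then have ae: "AE z in lborel. remainder_weight r V z * gauss_weight K z = 0"
    by (subst (asm) nn_integral_0_iff_AE) measurable
  have "eventually (\<lambda>t::real. r (t\<^sup>2) / ennreal (t\<^sup>2) < 1) (at 0)"
    using r(2) by (rule order_tendstoD) simp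
  then obtain d where d: "0 < d" "\<And>t. t \<noteq> 0 \<Longrightarrow> \<bar>t\<bar> < d \<Longrightarrow> r (t\<^sup>2) / ennreal (t\<^sup>2) < 1"
    by (auto simp: eventually_at dist_real_def)
  obtain e where e: "0 < e" "ball 0 e \<subseteq> V"
    using V by (auto simp: open_contains_ball)
  have nz: "remainder_weight r V z * gauss_weight K z \<noteq> 0" if "z \<in> ball 0 (min d e)" "z \<noteq> 0" for z
  proof -
    have "r ((norm z)\<^sup>2) \<noteq> top"
      using d(2)[of "norm z"] that by (auto simp: ennreal_top_divide)
    then obtain x where "r ((norm z)\<^sup>2) = ennreal x" "0 \<le> x"
      by (cases "r ((norm z)\<^sup>2)") auto
    moreover have "z \<in> V"
      using e that by auto
    ultimately show ?thesis
      by (simp add: remainder_weight_def gauss_weight_def enn2ereal_ennreal)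
  qed
  have "AE z in lborel. z \<noteq> (0 :: real ^ 'a)"
    by (rule AE_lborel_singleton)
  with ae have "AE z in lborel. z \<notin> ball (0 :: real ^ 'a) (min d e)"
    by eventually_elim (use nz in blast)
  then have "ball (0 :: real ^ 'a) (min d e) \<in> null_sets lborel"
    by (subst AE_iff_null_sets) auto
  then have "emeasure lborel (ball (0 :: real ^ 'a) (min d e)) = 0"
    by auto
  then have "negligible (ball (0 :: real ^ 'a) (min d e))"
    by (simp add: negligible_iff_emeasure0)
  then show False
    using d(1) e(1) by (simp add: open_not_negligible)
qed

lemma R_factor_le:
  fixes H0 :: "real ^ 'n ^ 'n"
  assumes r: "mono r" and H0: "posdef H0" and U: "convex U"
  shows "ennreal ((2 * pi) powr (real CARD('n) / 2)) * R_factor r H0 U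
    \<le> ennreal (sqrt (det H0)) * (\<integral>\<^sup>+z. remainder_weight r (interior U) z * gauss_weight H0 z \<partial>lborel)"
proof -
  let ?V = "interior U" and ?c = "(2 * pi) powr (real CARD('n) / 2)"
  let ?q = "remainder_weight r"
  note borel_measurable_remainder_weight[OF r borel_open[OF open_interior[of U]], measurable]
  obtain B where B: "H0 ** B = mat 1" "B ** H0 = mat 1"
    using posdef_det_pos[OF H0] invertible_det_nz[of H0] by (auto simp: invertible_def)
  have inv: "matrix_inv H0 = B" "matrix_inv B = H0"
    using B by (auto intro: matrix_inv_unique)
  have "det H0 * det B = 1"
    using B(1) by (metis det_mul det_I)
  then have detB: "det B = 1 / det H0"
    using posdef_det_pos[OF H0] by (simp add: field_simps)
  define D where "D z = ennreal (sqrt (det H0) / ?c) * gauss_weight H0 z" for z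
  have [measurable]: "D \<in> borel_measurable borel"
    unfolding D_def by measurable
  have "gaussian 0 (matrix_inv H0) = density lborel D"
    unfolding gaussian_def D_def inv
    by (intro arg_cong[where f="density lborel"] ext)
      (use posdef_det_pos[OF H0] in \<open>simp add: gauss_weight_def quad_def detB real_sqrt_divide ennreal_mult[symmetric] ac_simps\<close>)
  then have "R_factor r H0 U = (\<integral>\<^sup>+z. ?q U z \<partial>density lborel D)"
    by (simp add: R_factor_def remainder_weight_def)
  also have "\<dots> \<le> (\<integral>\<^sup>+z. ?q ?V z \<partial>density lborel D)"
  proof (rule nn_integral_mono_AE)
    show "AE z in density lborel D. ?q U z \<le> ?q ?V z"
      using AE_indicator_interior_convex[OF U]
      by (subst AE_density) (auto simp: remainder_weight_def elim!: eventually_mono)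
  qed
  also have "\<dots> = (\<integral>\<^sup>+z. ennreal (sqrt (det H0) / ?c) * (?q ?V z * gauss_weight H0 z) \<partial>lborel)"
    by (subst nn_integral_density) (auto simp: D_def ac_simps)
  also have "\<dots> = ennreal (sqrt (det H0) / ?c) * (\<integral>\<^sup>+z. ?q ?V z * gauss_weight H0 z \<partial>lborel)"
    by (rule nn_integral_cmult) measurable
  finally have "ennreal ?c * R_factor r H0 U
      \<le> ennreal ?c * (ennreal (sqrt (det H0) / ?c) * (\<integral>\<^sup>+z. ?q ?V z * gauss_weight H0 z \<partial>lborel))"
    by (rule mult_left_mono) simp
  also have "\<dots> = (ennreal ?c * ennreal (sqrt (det H0) / ?c)) * (\<integral>\<^sup>+z. ?q ?V z * gauss_weight H0 z \<partial>lborel)"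
    by (simp add: mult.assoc)
  also have "ennreal ?c * ennreal (sqrt (det H0) / ?c) = ennreal (sqrt (det H0))"
    using posdef_det_pos[OF H0] by (simp add: ennreal_mult[symmetric])
  finally show ?thesis .
qed

text \<open>The linear term integrates out because the remaining weight is even and \<open>cosh \<ge> 1\<close>.\<close>

lemma upper_smooth_integral_bound:
  fixes h :: "real ^ 'n \<Rightarrow> ereal"
  assumes [measurable]: "h \<in> borel_measurable borel"
    and h: "\<And>\<psi>. h \<psi> \<noteq> -\<infinity>"
    and bound: "\<And>u. h (\<theta> + u) \<le> h \<theta> + ereal (c + \<xi> \<bullet> u + quad K u / 2) + enn2ereal (r ((norm u)\<^sup>2))"
    and r: "mono r" and V: "open V" "uminus ` V = V" and \<theta>: "\<theta> \<in> \<Omega>"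
  shows "eexp (- h \<theta>) * (ennreal (exp (- c)) * (\<integral>\<^sup>+u. remainder_weight r V u * gauss_weight K u \<partial>lborel))
    \<le> (\<integral>\<^sup>+\<psi>\<in>\<Omega> + V. eexp (- h \<psi>) \<partial>lborel)"
proof -
  note borel_measurable_remainder_weight[OF r borel_open[OF V(1)], measurable]
  let ?k = "\<lambda>u. remainder_weight r V u * gauss_weight K u"
  let ?A = "eexp (- h \<theta>) * ennreal (exp (- c))"
  have pointwise: "?A * (ennreal (exp (- \<xi> \<bullet> u)) * ?k u) \<le> eexp (- h (\<theta> + u)) * indicator (\<Omega> + V) (\<theta> + u)" for u
  proof (cases "u \<in> V")
    case True
    have *: "ennreal (exp (- c)) * (ennreal (exp (- \<xi> \<bullet> u)) * gauss_weight K u)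
        = eexp (- ereal (c + \<xi> \<bullet> u + quad K u / 2))"
      by (simp add: gauss_weight_def ennreal_mult[symmetric] exp_add[symmetric] algebra_simps)
    have "?A * (ennreal (exp (- \<xi> \<bullet> u)) * ?k u)
        = eexp (- h \<theta>) * eexp (- ereal (c + \<xi> \<bullet> u + quad K u / 2)) * eexp (- enn2ereal (r ((norm u)\<^sup>2)))"
      unfolding *[symmetric] using True by (simp add: remainder_weight_def ac_simps)
    also have "\<dots> = eexp (- (h \<theta> + ereal (c + \<xi> \<bullet> u + quad K u / 2) + enn2ereal (r ((norm u)\<^sup>2))))"
      using h by (simp add: eexp_uminus_plus)
    also have "\<dots> \<le> eexp (- h (\<theta> + u))"
      using bound[of u] by (intro eexp_mono) simp
    finally show ?thesis
      using True \<theta> by (simp add: set_plus_intro)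
  qed (simp add: remainder_weight_def)
  have "\<Omega> + V = (\<Union>\<theta>\<in>\<Omega>. (+) \<theta> ` V)"
    by (auto simp: set_plus_def)
  then have "open (\<Omega> + V)"
    using V(1) by (auto intro: open_translation)
  then have [measurable]: "\<Omega> + V \<in> sets borel"
    by simp
  have "eexp (- h \<theta>) * (ennreal (exp (- c)) * (\<integral>\<^sup>+u. ?k u \<partial>lborel)) = ?A * (\<integral>\<^sup>+u. ?k u \<partial>lborel)"
    by (simp add: mult.assoc)
  also have "\<dots> \<le> ?A * (\<integral>\<^sup>+u. ennreal (exp (- \<xi> \<bullet> u)) * ?k u \<partial>lborel)"
    by (intro mult_left_mono nn_integral_exp_even_ge)
      (simp_all add: remainder_weight_even[OF V(2)] gauss_weight_def quad_uminus)
  also have "\<dots> = (\<integral>\<^sup>+u. ?A * (ennreal (exp (- \<xi> \<bullet> u)) * ?k u) \<partial>lborel)"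
    by (rule nn_integral_cmult[symmetric]) measurable
  also have "\<dots> \<le> (\<integral>\<^sup>+u. eexp (- h (\<theta> + u)) * indicator (\<Omega> + V) (\<theta> + u) \<partial>lborel)"
    by (intro nn_integral_mono pointwise)
  also have "\<dots> = (\<integral>\<^sup>+\<psi>\<in>\<Omega> + V. eexp (- h \<psi>) \<partial>lborel)"
    by (rule nn_integral_lborel_translation[of "\<lambda>\<psi>. eexp (- h \<psi>) * indicator (\<Omega> + V) \<psi>"]) measurable
  finally show ?thesis .
qed

theorem theorem1:
  fixes \<nu> :: "'x measure"
    and f :: "'x \<Rightarrow> real ^ 'p \<Rightarrow> ereal"
    and g :: "'d::finite \<Rightarrow> real ^ 'p \<Rightarrow> ereal"
    and \<Omega> \<Omega>0 U :: "(real ^ 'p) set"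
    and A :: "(real ^ 'd) set"
    and theta_hat :: "'x \<Rightarrow> real ^ 'd \<Rightarrow> real ^ 'p"
    and H0 :: "real ^ 'p ^ 'p" and H :: "'d \<Rightarrow> real ^ 'p ^ 'p"
    and c0 :: real and c :: "'d \<Rightarrow> real"
    and r :: "real \<Rightarrow> ennreal"
    and lam :: "real ^ 'd"
  assumes sigma_finite: "sigma_finite_measure \<nu>"
    and f_measurable: "(\<lambda>(X, \<theta>). f X \<theta>) \<in> borel_measurable (\<nu> \<Otimes>\<^sub>M borel)"
    and g_measurable: "\<And>j. g j \<in> borel_measurable borel"
    and f_range: "\<And>X \<theta>. X \<in> space \<nu> \<Longrightarrow> f X \<theta> \<noteq> -\<infinity>"
    and g_range: "\<And>j \<theta>. g j \<theta> \<noteq> -\<infinity>"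
    and closed_Omega0: "closed \<Omega>0"
    and log_loss: "\<And>\<theta>. \<theta> \<in> \<Omega>0 \<Longrightarrow> (\<integral>\<^sup>+X. eexp (- f X \<theta>) \<partial>\<nu>) = 1"
    and Omega_subset: "\<Omega> \<subseteq> \<Omega>0"
    and convex_A: "convex A"
    and A_nonneg: "\<And>l j. l \<in> A \<Longrightarrow> 0 \<le> l $ j"
    and minimizer: "\<And>X l. X \<in> space \<nu> \<Longrightarrow> l \<in> A \<Longrightarrow>
          theta_hat X l \<in> \<Omega> \<and>
          (\<forall>\<theta>\<in>\<Omega>. f X (theta_hat X l) + penalty g l (theta_hat X l) \<le> f X \<theta> + penalty g l \<theta>)"
    and regular: "\<And>X l l'. X \<in> space \<nu> \<Longrightarrow> l \<in> A \<Longrightarrow> l' \<in> A \<Longrightarrow> (\<forall>j. l $ j \<le> l' $ j) \<Longrightarrow>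
          theta_hat X l \<in> interior \<Omega> \<Longrightarrow> theta_hat X l' \<in> interior \<Omega>"
    and f_smooth: "\<And>X. X \<in> space \<nu> \<Longrightarrow> upper_smooth (f X) \<Omega> H0 c0 r"
    and g_smooth: "\<And>j. upper_smooth (g j) \<Omega> (H j) (c j) (\<lambda>_. 0)"
    and H0_invertible: "invertible H0"
    and U_neighborhood: "0 \<in> interior U"
    and U_symmetric: "uminus ` U = U"
    and U_convex: "convex U"
    and U_subset: "\<Omega> + U \<subseteq> \<Omega>0"
    and lam_in: "lam \<in> A"
  shows "Z_factor \<nu> f g \<Omega> lam \<le>
           ennreal (exp (c_bar c0 c lam) * sqrt (det (H_bar H0 H lam)))
             / (ennreal ((2 * pi) powr (real CARD('p) / 2)) * R_factor r H0 U)
             * (\<integral>\<^sup>+\<theta>\<in>\<Omega> + U. eexp (- penalty g lam \<theta>) \<partial>lborel)"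
proof (cases "space \<nu> = {}")
  case True
  then show ?thesis
    by (simp add: Z_factor_def nn_integral_empty)
next
  case False
  then obtain X0 where X0: "X0 \<in> space \<nu>" by auto
  let ?V = "interior U" and ?K = "H_bar H0 H lam" and ?C = "c_bar c0 c lam"
    and ?pen = "penalty g lam" and ?c = "(2 * pi) powr (real CARD('p) / 2)"
  define J where "J K = (\<integral>\<^sup>+z. remainder_weight r ?V z * gauss_weight K z \<partial>lborel)" for K
  define h where "h X \<theta> = f X \<theta> + ?pen \<theta>" for X \<theta>
  have lam: "0 \<le> lam $ j" for j
    using A_nonneg[OF lam_in] .
  have r: "mono r" "((\<lambda>t::real. r (t\<^sup>2) / ennreal (t\<^sup>2)) \<longlongrightarrow> 0) (at 0)" and psd0: "psd H0"
    using f_smooth[OF X0] by (auto simp: upper_smooth_def)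
  have psdH: "psd (H j)" for j
    using g_smooth[of j] by (simp add: upper_smooth_def)
  have pos0: "posdef H0"
    using psd0 H0_invertible by (rule psd_invertible_posdef)
  have psdD: "psd (\<Sum>j\<in>UNIV. lam $ j *\<^sub>R H j)"
    using lam psdH by (intro psd_sum_scaleR)
  have posK: "posdef ?K"
    unfolding H_bar_def using pos0 psdD by (rule posdef_add_psd)
  have V: "open ?V" "0 \<in> ?V" "convex ?V" "uminus ` ?V = ?V"
    using U_neighborhood U_convex interior_negations[of U] U_symmetric
    by (auto intro: convex_interior)
  note borel_measurable_remainder_weight[OF r(1) borel_open[OF V(1)], measurable]
  have J_pos: "0 < J ?K"
    unfolding J_def by (rule remainder_weight_integral_pos[OF r V(1,2)])
  have J_fin: "J ?K < top"
  proof -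
    have "remainder_weight r ?V z \<le> 1" for z
      using eexp_mono[of "- enn2ereal (r ((norm z)\<^sup>2))" 0]
      by (simp add: remainder_weight_def indicator_def) (simp add: zero_ereal_def)
    then have "J ?K \<le> (\<integral>\<^sup>+z. 1 * gauss_weight ?K z \<partial>lborel)"
      unfolding J_def by (intro nn_integral_mono mult_right_mono) auto
    also have "\<dots> < top"
      using nn_integral_gauss_weight_finite[OF posK] by simp
    finally show ?thesis .
  qed
  have R_le: "ennreal ?c * R_factor r H0 U \<le> ennreal (sqrt (det ?K)) * J ?K"
  proof -
    have "ennreal ?c * R_factor r H0 U \<le> ennreal (sqrt (det H0)) * J H0"
      unfolding J_def by (rule R_factor_le[OF r(1) pos0 U_convex])
    also have "\<dots> \<le> ennreal (sqrt (det ?K)) * J ?K"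
      unfolding J_def H_bar_def
      by (rule gauss_weight_mono[OF _ remainder_weight_even[OF V(4)]
            remainder_weight_quasiconcave[OF r(1) V(3)] pos0 psdD]) measurable
    finally show ?thesis .
  qed

  have pen_minf: "?pen \<theta> \<noteq> -\<infinity>" for \<theta>
    using g_range lam by (rule penalty_not_minfty)
  have h_minf: "h X \<theta> \<noteq> -\<infinity>" if "X \<in> space \<nu>" for X \<theta>
    using f_range[OF that] pen_minf by (simp add: h_def)
  have eexp_h: "eexp (- f X \<theta> - ?pen \<theta>) = eexp (- h X \<theta>)"
      "eexp (- h X \<theta>) = eexp (- f X \<theta>) * eexp (- ?pen \<theta>)" if "X \<in> space \<nu>" for X \<theta>
    using f_range[OF that, of \<theta>] pen_minf[of \<theta>] eexp_uminus_plus[of "f X \<theta>" "?pen \<theta>"]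
    by (auto simp: h_def) (cases "f X \<theta>"; cases "?pen \<theta>"; simp)
  note f_measurable[measurable] g_measurable[measurable]
  have pen_meas[measurable]: "?pen \<in> borel_measurable borel"
    unfolding penalty_def by measurable
  have f_meas_X[measurable]: "f X \<in> borel_measurable borel" if "X \<in> space \<nu>" for X
    using measurable_compose[OF measurable_Pair1'[OF that] f_measurable] by simp
  have h_meas[measurable]: "h X \<in> borel_measurable borel" if "X \<in> space \<nu>" for X
    unfolding h_def using f_meas_X[OF that] by measurable

  have smooth: "\<exists>\<xi>. \<forall>u. h X (\<theta> + u) \<le> h X \<theta> + ereal (?C + \<xi> \<bullet> u + quad ?K u / 2) + enn2ereal (r ((norm u)\<^sup>2))"
    if X: "X \<in> space \<nu>" and \<theta>: "\<theta> \<in> \<Omega>" for X \<theta>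
  proof -
    obtain \<xi>0 where \<xi>0: "\<And>\<psi>. f X \<psi> \<le> f X \<theta> + ereal (c0 + \<xi>0 \<bullet> (\<psi> - \<theta>) + 1 / 2 * quad H0 (\<psi> - \<theta>))
        + enn2ereal (r ((norm (\<theta> - \<psi>))\<^sup>2))"
      using f_smooth[OF X] \<theta> unfolding upper_smooth_def quad_def by blast
    have "\<exists>\<xi>. \<forall>\<psi>. g j \<psi> \<le> g j \<theta> + ereal (c j + \<xi> \<bullet> (\<psi> - \<theta>) + 1 / 2 * quad (H j) (\<psi> - \<theta>))" for j
      using g_smooth[of j] \<theta> unfolding upper_smooth_def quad_def by (simp add: zero_ennreal.rep_eq) blast
    then obtain \<xi>g where \<xi>g: "\<And>j \<psi>. g j \<psi> \<le> g j \<theta> + ereal (c j + \<xi>g j \<bullet> (\<psi> - \<theta>) + 1 / 2 * quad (H j) (\<psi> - \<theta>))"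
      by metis
    let ?\<xi> = "\<xi>0 + (\<Sum>j\<in>UNIV. lam $ j *\<^sub>R \<xi>g j)"
    have "h X (\<theta> + u) \<le> h X \<theta> + ereal (?C + ?\<xi> \<bullet> u + quad ?K u / 2) + enn2ereal (r ((norm u)\<^sup>2))" for u
    proof -
      let ?F = "c0 + \<xi>0 \<bullet> u + 1 / 2 * quad H0 u"
      let ?G = "\<Sum>j\<in>UNIV. lam $ j * (c j + \<xi>g j \<bullet> u + 1 / 2 * quad (H j) u)"
      have "?pen (\<theta> + u) \<le> ?pen \<theta> + ereal ?G"
        using \<xi>g[of _ "\<theta> + u"] by (intro penalty_upper_bound lam) simp
      moreover have "f X (\<theta> + u) \<le> f X \<theta> + ereal ?F + enn2ereal (r ((norm u)\<^sup>2))"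
        using \<xi>0[of "\<theta> + u"] by (simp add: norm_minus_commute)
      ultimately have "h X (\<theta> + u) \<le> f X \<theta> + ereal ?F + enn2ereal (r ((norm u)\<^sup>2)) + (?pen \<theta> + ereal ?G)"
        unfolding h_def by (intro add_mono)
      also have "\<dots> = h X \<theta> + (ereal ?F + ereal ?G) + enn2ereal (r ((norm u)\<^sup>2))"
        unfolding h_def by (simp only: ac_simps)
      also have "ereal ?F + ereal ?G = ereal (?C + ?\<xi> \<bullet> u + quad ?K u / 2)"
        by (simp add: c_bar_def H_bar_def quad_add_matrix quad_sum_scaleR inner_add_left inner_sum_left
            distrib_left sum.distrib sum_divide_distrib[symmetric])
      finally show ?thesis .
    qed
    then show ?thesis by blast
  qed

  have "\<Omega> + ?V = (\<Union>\<theta>\<in>\<Omega>. (+) \<theta> ` ?V)"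
    by (auto simp: set_plus_def)
  then have [measurable]: "\<Omega> + ?V \<in> sets borel"
    by (auto intro!: borel_open open_translation)
  have sub: "\<Omega> + ?V \<subseteq> \<Omega> + U"
    by (intro set_plus_mono2 interior_subset order_refl)

  define B where "B X = (\<integral>\<^sup>+\<psi>\<in>\<Omega> + ?V. eexp (- f X \<psi>) * eexp (- ?pen \<psi>) \<partial>lborel)" for X
  define \<kappa> where "\<kappa> = ennreal (exp (- ?C)) * J ?K"
  have \<kappa>: "0 < \<kappa>" "\<kappa> < top"
    using J_pos J_fin by (auto simp: \<kappa>_def ennreal_zero_less_mult_iff ennreal_mult_less_top)
  have sup_le: "(SUP \<theta>\<in>\<Omega>. eexp (- f X \<theta> - ?pen \<theta>)) \<le> B X / \<kappa>" if X: "X \<in> space \<nu>" for X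
  proof (rule SUP_least)
    fix \<theta> assume \<theta>: "\<theta> \<in> \<Omega>"
    obtain \<xi> where "\<And>u. h X (\<theta> + u) \<le> h X \<theta> + ereal (?C + \<xi> \<bullet> u + quad ?K u / 2) + enn2ereal (r ((norm u)\<^sup>2))"
      using smooth[OF X \<theta>] by blast
    from upper_smooth_integral_bound[OF h_meas[OF X] h_minf[OF X] this r(1) V(1,4) \<theta>]
    have "eexp (- h X \<theta>) * \<kappa> \<le> B X"
      by (simp add: \<kappa>_def J_def B_def eexp_h(2)[OF X])
    then have "eexp (- h X \<theta>) * \<kappa> / \<kappa> \<le> B X / \<kappa>"
      by (rule divide_right_mono_ennreal)
    then show "eexp (- f X \<theta> - ?pen \<theta>) \<le> B X / \<kappa>"
      using \<kappa> by (simp add: eexp_h(1)[OF X] ennreal_mult_divide_eq)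
  qed

  interpret pair_sigma_finite \<nu> "lborel :: (real ^ 'p) measure"
    using sigma_finite by (simp add: pair_sigma_finite_def sigma_finite_lborel)
  let ?E = "\<lambda>X \<psi>. eexp (- f X \<psi>) * eexp (- ?pen \<psi>) * indicator (\<Omega> + ?V) \<psi>"
  have f_meas': "(\<lambda>(X, \<theta>). f X \<theta>) \<in> borel_measurable (\<nu> \<Otimes>\<^sub>M lborel)"
    using f_measurable by (simp cong: measurable_cong_sets add: sets_pair_measure_cong[OF refl sets_lborel])
  have E_meas[measurable]: "(\<lambda>(X, \<psi>). ?E X \<psi>) \<in> borel_measurable (\<nu> \<Otimes>\<^sub>M lborel)"
    using f_meas' by measurable
  have B_meas: "B \<in> borel_measurable \<nu>"
    unfolding B_def by measurable
  have "Z_factor \<nu> f g \<Omega> lam \<le> (\<integral>\<^sup>+X. B X / \<kappa> \<partial>\<nu>)"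
    unfolding Z_factor_def by (intro nn_integral_mono sup_le)
  also have "\<dots> = (\<integral>\<^sup>+X. B X \<partial>\<nu>) / \<kappa>"
    by (rule nn_integral_divide[OF B_meas])
  also have "(\<integral>\<^sup>+X. B X \<partial>\<nu>) = (\<integral>\<^sup>+\<psi>. (\<integral>\<^sup>+X. ?E X \<psi> \<partial>\<nu>) \<partial>lborel)"
    unfolding B_def by (rule Fubini'[symmetric]) (rule E_meas)
  also have "\<dots> = (\<integral>\<^sup>+\<psi>\<in>\<Omega> + ?V. eexp (- ?pen \<psi>) \<partial>lborel)"
  proof (intro nn_integral_cong)
    fix \<psi>
    have [measurable]: "(\<lambda>X. f X \<psi>) \<in> borel_measurable \<nu>"
      using measurable_compose[OF measurable_Pair2'[of \<psi> borel \<nu>] f_measurable] by simp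
    have "(\<integral>\<^sup>+X. ?E X \<psi> \<partial>\<nu>) = (\<integral>\<^sup>+X. eexp (- f X \<psi>) \<partial>\<nu>) * (eexp (- ?pen \<psi>) * indicator (\<Omega> + ?V) \<psi>)"
      unfolding mult.assoc by (rule nn_integral_multc) measurable
    then show "(\<integral>\<^sup>+X. ?E X \<psi> \<partial>\<nu>) = eexp (- ?pen \<psi>) * indicator (\<Omega> + ?V) \<psi>"
      using log_loss[of \<psi>] sub U_subset by (cases "\<psi> \<in> \<Omega> + ?V") auto
  qed
  also have "\<dots> / \<kappa> \<le> (\<integral>\<^sup>+\<psi>\<in>\<Omega> + U. eexp (- ?pen \<psi>) \<partial>lborel) / \<kappa>"
    using sub by (intro divide_right_mono_ennreal nn_integral_mono) (auto simp: indicator_def)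
  also have "\<dots> = 1 / \<kappa> * (\<integral>\<^sup>+\<psi>\<in>\<Omega> + U. eexp (- ?pen \<psi>) \<partial>lborel)"
    by (simp add: divide_ennreal_def mult.commute)
  also have "\<dots> \<le> ennreal (exp ?C * sqrt (det ?K)) / (ennreal ?c * R_factor r H0 U)
      * (\<integral>\<^sup>+\<psi>\<in>\<Omega> + U. eexp (- ?pen \<psi>) \<partial>lborel)"
  proof (rule mult_right_mono)
    obtain j where j: "0 < j" "J ?K = ennreal j"
      using J_pos J_fin by (cases "J ?K") auto
    let ?s = "sqrt (det ?K)"
    have s: "0 < ?s"
      using posdef_det_pos[OF posK] by simp
    have "1 / \<kappa> = ennreal (exp ?C * ?s) / ennreal (?s * j)"
      using s j by (simp add: \<kappa>_def ennreal_mult[symmetric] divide_ennreal exp_minus field_simps flip: ennreal_1)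
    also have "\<dots> \<le> ennreal (exp ?C * ?s) / (ennreal ?c * R_factor r H0 U)"
      unfolding divide_ennreal_def using R_le s j
      by (intro mult_left_mono ennreal_inverse_antimono) (simp_all add: ennreal_mult)
    finally show "1 / \<kappa> \<le> \<dots>" .
  qed simp
  finally show ?thesis
    by simp
qed

end
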